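(* Let $K\subset\mathcal A(\nu,p_0,\lambda,M)$ be a compact set of coefficients $a=(b,\sigma)$ for some $\nu>0$, $p_0>2$, $\lambda>0$, $M>0$. Fix $\alpha\in(0,1)$, $S<\infty$, $p>2$, and a constant $C_{\alpha,S}<\infty$ not depending on $R$ or $\theta$. Then there is a constant $C_{\alpha,S,p}<\infty$, not depending on $R$, $\theta$ or $a\in K$, such that the following holds for every $R>0$ and every neural operator $\mathcal N_\theta$. Assume that $\mathcal N_\theta(a)$ is locally Lipschitz in $x$ and satisfies $$|\mathcal N_\theta(a)(x,t)|\le C_{\alpha,S}(1+|x|),\qquad a\in K,\ x\in\mathbb R^d,\ t\in[0,1],$$ and define $$\delta_{\theta,\alpha,S,R}:=\sup_{a\in K}\ \sup_{(x,t)\in\overline B_{2R}\times[0,1]}|\mathcal N_\theta(a)(x,t)-v^{a,R}(x,t)| .$$ If $\delta_{\theta,\alpha,S,R}<Re^{-L_{\alpha,S,R}}$ and $\hat\mu_{a,\theta}$ is the terminal law (law of $X_1$) generated by $\dot X_t=\mathcal N_\theta(a)(X_t,t)$ from $X_0\sim\gamma$, then $$\sup_{a\in K}W_2(\hat\mu_{a,\theta},\mu_a)\le e^{L_{\alpha,S,R}}\delta_{\theta,\alpha,S,R}+C_{\alpha,S,p}R^{-(p-2)/2}+\varepsilon_{\mathrm{trun}}(\alpha,S,R)+\sqrt{\alpha d}+M_{p_0}^{1/2}S^{-(p_0-2)/2}.$$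
   Context: Fix $d,d_W$. For $a=(b,\sigma)$ with $b:\mathbb R^d\to\mathbb R^d$, $\sigma:\mathbb R^d\to\mathbb R^{d\times d_W}$ continuous, put $A_a=\sigma\sigma^\top$ and $\mathcal L_a\varphi=b\cdot\nabla\varphi+\frac12\operatorname{Tr}(A_aD^2\varphi)$. $\mathcal X_a=C(\mathbb R^d;\mathbb R^d)\times C(\mathbb R^d;\mathbb R^{d\times d_W})$ carries the compact-open topology. $\mathcal A(\nu,p_0,\lambda,M)$ is the set of $a\in\mathcal X_a$ such that for all $x$: $A_a(x)\succeq\nu I$ and $\langle b(x),x\rangle+\frac12(p_0-1)\operatorname{Tr}A_a(x)\le-\lambda|x|^2+M$. It is standard that for such $a$ there is a unique probability measure $\mu_a$ with $\int\mathcal L_a\varphi\,d\mu_a=0$ for all $\varphi\in C_c^\infty(\mathbb R^d)$, and $\sup_{a\in\mathcal A(\nu,p_0,\lambda,M)}\int|x|^p\,d\mu_a\le M_p<\infty$ for $2\le p\le p_0$; this defines $M_{p_0}$. $W_2$ is the quadratic Wasserstein distance; $\gamma=\mathcal N(0,I_d)$; $\mathcal N_\theta$ maps $a$ to a field $\mathcal N_\theta(a)\in C(\mathbb R^d\times[0,1];\mathbb R^d)$. Let $P_S:\mathbb R^d\to\overline B_S$ be the radial projection and $\mu_a^S=(P_S)_\#\mu_a$. Let $\gamma_\alpha=\mathcal N(0,(1-\alpha)I_d)$, $\phi_\alpha(u)=(2\pi\alpha)^{-d/2}e^{-|u|^2/(2\alpha)}$, and $$\rho_t^a(z)=\int\phi_\alpha(z-((1-t)x+ty))\,\gamma_\alpha(dx)\mu_a^S(dy),\quad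 J_t^a(z)=\int(y-x)\phi_\alpha(z-((1-t)x+ty))\,\gamma_\alpha(dx)\mu_a^S(dy),$$ $v^a(z,t)=J_t^a(z)/\rho_t^a(z)$; $\rho_t^a$ also denotes the probability measure with this density. For each $R>0$, $\chi_R\in C_c^\infty(\mathbb R^d)$ is a fixed cutoff with $0\le\chi_R\le1$, $\chi_R=1$ for $|x|\le R$, $\chi_R=0$ for $|x|\ge2R$; $v^{a,R}(x,t)=\chi_R(x)v^a(x,t)$. $L_{\alpha,S,R}=\sup_{a\in\mathcal A(\nu,p_0,\lambda,M)}\sup_{t\in[0,1]}\operatorname{Lip}_xv^{a,R}(\cdot,t)$, which is finite. $\mu_a^{S,R}$ is the law of $X_1$ for $\dot X_t=v^{a,R}(X_t,t)$, $X_0\sim\gamma$, and $\varepsilon_{\mathrm{trun}}(\alpha,S,R)=\sup_{a\in\mathcal A(\nu,p_0,\lambda,M)}W_2(\rho_1^a,\mu_a^{S,R})$. *)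

theory Defs
  imports "HOL-Probability.Probability"
begin

section \<open>Smooth test functions\<close>

definition partial :: "'d::finite \<Rightarrow> (real^'d \<Rightarrow> real) \<Rightarrow> real^'d \<Rightarrow> real" where
  "partial i f x = frechet_derivative f (at x) (axis i 1)"

definition gradient :: "(real^'d::finite \<Rightarrow> real) \<Rightarrow> real^'d \<Rightarrow> real^'d" where
  "gradient f x = (\<chi> i. partial i f x)"

definition hessian :: "(real^'d::finite \<Rightarrow> real) \<Rightarrow> real^'d \<Rightarrow> real^'d^'d" where
  "hessian f x = (\<chi> i j. partial i (partial j f) x)"

primrec C_k :: "nat \<Rightarrow> (real^'d::finite \<Rightarrow> real) \<Rightarrow> bool" where
  "C_k 0 f \<longleftrightarrow> continuous_on UNIV f"
| "C_k (Suc k) f \<longleftrightarrow> f differentiable_on UNIV \<and> (\<forall>i. C_k k (partial i f))"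

definition Cc_infinity :: "(real^'d::finite \<Rightarrow> real) set" where
  "Cc_infinity = {f. (\<forall>k. C_k k f) \<and> compact (closure {x. f x \<noteq> 0})}"

section \<open>Coefficients, generator, stationary measures\<close>

type_synonym ('d, 'w) coeff = "(real^'d \<Rightarrow> real^'d) \<times> (real^'d \<Rightarrow> real^'w^'d)"

text \<open>The carrier of this topology consists of the continuous functions only
  (take \<open>C\<close> to be empty).\<close>
definition compact_open :: "('a::topological_space \<Rightarrow> 'b::topological_space) topology" where
  "compact_open = topology_generated_by
     {{f. continuous_on UNIV f \<and> f ` C \<subseteq> U} | C U. compact C \<and> open U}"

definition coeff_topology :: "('d::finite, 'w::finite) coeff topology" where
  "coeff_topology = prod_topology compact_open compact_open"

definition diffusion :: "('d::finite, 'w::finite) coeff \<Rightarrow> real^'d \<Rightarrow> real^'d^'d" where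
  "diffusion a x = snd a x ** transpose (snd a x)"

definition psd :: "real^'d^'d::finite \<Rightarrow> bool" where
  "psd B \<longleftrightarrow> transpose B = B \<and> (\<forall>\<xi>. 0 \<le> \<xi> \<bullet> (B *v \<xi>))"

definition generator ::
  "('d::finite, 'w::finite) coeff \<Rightarrow> (real^'d \<Rightarrow> real) \<Rightarrow> real^'d \<Rightarrow> real" where
  "generator a f x =
     fst a x \<bullet> gradient f x + 1/2 * trace (diffusion a x ** hessian f x)"

definition admissible ::
  "real \<Rightarrow> real \<Rightarrow> real \<Rightarrow> real \<Rightarrow> ('d::finite, 'w::finite) coeff set" where
  "admissible \<nu> p\<^sub>0 lam M = {a. a \<in> topspace coeff_topology \<and>
     (\<forall>x. psd (diffusion a x - \<nu> *\<^sub>R mat 1) \<and>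
          fst a x \<bullet> x + 1/2 * (p\<^sub>0 - 1) * trace (diffusion a x) \<le> - lam * (norm x)\<^sup>2 + M)}"

definition stationary :: "('d::finite, 'w::finite) coeff \<Rightarrow> (real^'d) measure \<Rightarrow> bool" where
  "stationary a m \<longleftrightarrow> prob_space m \<and> sets m = sets borel \<and>
     (\<forall>f\<in>Cc_infinity. (\<integral>x. generator a f x \<partial>m) = 0)"

section \<open>Quadratic Wasserstein distance\<close>

definition couplings ::
  "'a::topological_space measure \<Rightarrow> 'a measure \<Rightarrow> ('a \<times> 'a) measure set" where
  "couplings m n = {c. prob_space c \<and> sets c = sets (borel \<Otimes>\<^sub>M borel) \<and>
     distr c borel fst = m \<and> distr c borel snd = n}"

definition ennsqrt :: "ennreal \<Rightarrow> ennreal" where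
  "ennsqrt x = (if x = \<infinity> then \<infinity> else ennreal (sqrt (enn2real x)))"

definition W2 :: "'a::metric_space measure \<Rightarrow> 'a measure \<Rightarrow> ennreal" where
  "W2 m n = ennsqrt (INF c\<in>couplings m n. \<integral>\<^sup>+z. ennreal ((dist (fst z) (snd z))\<^sup>2) \<partial>c)"

section \<open>Regularised flow-matching field\<close>

definition gauss_density :: "real \<Rightarrow> real^'d::finite \<Rightarrow> real" where
  "gauss_density s u = (2 * pi * s) powr (- real CARD('d) / 2) * exp (- (norm u)\<^sup>2 / (2 * s))"

text \<open>Centred Gaussian with covariance \<open>s\<close> times the identity.\<close>
definition gauss :: "real \<Rightarrow> (real^'d::finite) measure" where
  "gauss s = density lborel (\<lambda>u. ennreal (gauss_density s u))"

definition radial_proj :: "real \<Rightarrow> 'a::real_normed_vector \<Rightarrow> 'a" where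
  "radial_proj S x = (if norm x \<le> S then x else (S / norm x) *\<^sub>R x)"

definition truncate :: "real \<Rightarrow> (real^'d::finite) measure \<Rightarrow> (real^'d) measure" where
  "truncate S m = distr m borel (radial_proj S)"

text \<open>In the next five definitions \<open>m\<close> stands for the untruncated stationary measure of \<open>a\<close>,
  the only way in which they depend on \<open>a\<close>.\<close>
definition rho :: "real \<Rightarrow> real \<Rightarrow> (real^'d::finite) measure \<Rightarrow> real \<Rightarrow> real^'d \<Rightarrow> real" where
  "rho \<alpha> S m t z = (\<integral>w. gauss_density \<alpha> (z - ((1 - t) *\<^sub>R fst w + t *\<^sub>R snd w))
     \<partial>(gauss (1 - \<alpha>) \<Otimes>\<^sub>M truncate S m))"

definition rho_measure ::
  "real \<Rightarrow> real \<Rightarrow> (real^'d::finite) measure \<Rightarrow> real \<Rightarrow> (real^'d) measure" where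
  "rho_measure \<alpha> S m t = density lborel (\<lambda>z. ennreal (rho \<alpha> S m t z))"

definition flux :: "real \<Rightarrow> real \<Rightarrow> (real^'d::finite) measure \<Rightarrow> real \<Rightarrow> real^'d \<Rightarrow> real^'d" where
  "flux \<alpha> S m t z =
     (\<integral>w. gauss_density \<alpha> (z - ((1 - t) *\<^sub>R fst w + t *\<^sub>R snd w)) *\<^sub>R (snd w - fst w)
     \<partial>(gauss (1 - \<alpha>) \<Otimes>\<^sub>M truncate S m))"

definition velocity ::
  "real \<Rightarrow> real \<Rightarrow> (real^'d::finite) measure \<Rightarrow> real^'d \<Rightarrow> real \<Rightarrow> real^'d" where
  "velocity \<alpha> S m z t = flux \<alpha> S m t z /\<^sub>R rho \<alpha> S m t z"

definition cut_velocity ::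
  "(real \<Rightarrow> real^'d::finite \<Rightarrow> real) \<Rightarrow> real \<Rightarrow> real \<Rightarrow> real \<Rightarrow> (real^'d) measure
     \<Rightarrow> real^'d \<Rightarrow> real \<Rightarrow> real^'d" where
  "cut_velocity chi \<alpha> S R m x t = chi R x *\<^sub>R velocity \<alpha> S m x t"

definition cutoff_family :: "(real \<Rightarrow> real^'d::finite \<Rightarrow> real) \<Rightarrow> bool" where
  "cutoff_family chi \<longleftrightarrow> (\<forall>R>0. chi R \<in> Cc_infinity \<and> (\<forall>x. 0 \<le> chi R x \<and> chi R x \<le> 1 \<and>
     (norm x \<le> R \<longrightarrow> chi R x = 1) \<and> (2 * R \<le> norm x \<longrightarrow> chi R x = 0)))"

section \<open>Terminal laws of flows and error quantities\<close>

definition terminal_map :: "(real^'d::finite \<Rightarrow> real \<Rightarrow> real^'d) \<Rightarrow> real^'d \<Rightarrow> real^'d" where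
  "terminal_map v x = (THE y. \<exists>X. X 0 = x \<and> X 1 = y \<and>
     (\<forall>t\<in>{0..1}. (X has_vector_derivative v (X t) t) (at t within {0..1})))"

definition terminal_law :: "(real^'d::finite \<Rightarrow> real \<Rightarrow> real^'d) \<Rightarrow> (real^'d) measure" where
  "terminal_law v = distr (gauss 1) borel (terminal_map v)"

text \<open>The pairs with \<open>x = y\<close> contribute \<open>0 / 0 = 0\<close>.\<close>
definition Lip :: "('a::metric_space \<Rightarrow> 'b::metric_space) \<Rightarrow> ennreal" where
  "Lip f = (SUP (x, y)\<in>UNIV. ennreal (dist (f x) (f y) / dist x y))"

text \<open>Suprema of nonnegative quantities are taken in \<open>ennreal\<close>, so that a supremum over the empty
  set is \<open>0\<close>. \<open>A\<close> is the full class of admissible coefficients and \<open>\<mu> a\<close> the stationary measure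
  of \<open>a\<close>.\<close>
definition lip_const ::
  "('d::finite, 'w::finite) coeff set \<Rightarrow> (('d, 'w) coeff \<Rightarrow> (real^'d) measure)
     \<Rightarrow> (real \<Rightarrow> real^'d \<Rightarrow> real) \<Rightarrow> real \<Rightarrow> real \<Rightarrow> real \<Rightarrow> ennreal" where
  "lip_const A \<mu> chi \<alpha> S R =
     (SUP a\<in>A. SUP t\<in>{0..1}. Lip (\<lambda>x. cut_velocity chi \<alpha> S R (\<mu> a) x t))"

definition eps_trun ::
  "('d::finite, 'w::finite) coeff set \<Rightarrow> (('d, 'w) coeff \<Rightarrow> (real^'d) measure)
     \<Rightarrow> (real \<Rightarrow> real^'d \<Rightarrow> real) \<Rightarrow> real \<Rightarrow> real \<Rightarrow> real \<Rightarrow> ennreal" where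
  "eps_trun A \<mu> chi \<alpha> S R =
     (SUP a\<in>A. W2 (rho_measure \<alpha> S (\<mu> a) 1) (terminal_law (cut_velocity chi \<alpha> S R (\<mu> a))))"

definition field_error ::
  "('d::finite, 'w::finite) coeff set \<Rightarrow> (('d, 'w) coeff \<Rightarrow> (real^'d) measure)
     \<Rightarrow> (real \<Rightarrow> real^'d \<Rightarrow> real) \<Rightarrow> real \<Rightarrow> real \<Rightarrow> real
     \<Rightarrow> (('d, 'w) coeff \<Rightarrow> real^'d \<Rightarrow> real \<Rightarrow> real^'d) \<Rightarrow> ennreal" where
  "field_error K \<mu> chi \<alpha> S R N = (SUP a\<in>K. SUP (x, t)\<in>cball 0 (2 * R) \<times> {0..1}.
     ennreal (norm (N a x t - cut_velocity chi \<alpha> S R (\<mu> a) x t)))"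

end

theory Submission
  imports Defs
begin

text \<open>Write \<open>T\<close> and \<open>U\<close> for the terminal maps of the learned field and of the truncated
  velocity. Along trajectories of the truncated velocity that stay in the ball of radius \<open>R\<close>,
  Gronwall's inequality gives \<open>|T - U| \<le> e\<^sup>L \<delta>\<close>; the remaining starting points are far from
  the origin because both fields grow at most linearly, uniformly in \<open>R\<close>, and so contribute only a
  Gaussian tail. For the velocity the linear growth is a bound on a Gaussian posterior mean.

  The triangle inequality for \<open>W2\<close> along \<open>T\<^sub># \<gamma>\<close>, \<open>U\<^sub># \<gamma>\<close>, \<open>\<rho>\<^sub>1\<close>, \<open>\<mu>\<close> requires no general gluing
  theorem: \<open>U\<close> is inverted by the backward flow, and the law of the point of \<open>\<mu>\<close> given the
  mollified point has an explicit density. The distances of the last step are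
  \<open>\<surd>(\<alpha> d)\<close>, the size of the mollifying noise, and the moment bound for the radial projection.\<close>

section \<open>Flows of time-dependent vector fields\<close>

text \<open>The tail constant must not depend on \<open>R\<close>, while the Lipschitz constant
  \<open>L\<close> of the truncated velocity does. Hence \<open>L\<close> is used only for starting
  points whose reference trajectory is known to stay in the ball of radius \<open>R\<close>; for all
  others the two end points are bounded by the growth constant alone. The assumption \<delta> < R
  exp(-L) keeps the deviation below \<open>R\<close>, so the learned trajectory stays within radius
  2R, exactly where \<delta> measures the error. The rate comes from h^2 \<le> h^p R^(-(p-2)) for h
  > R, where h is of order 1 + |x|: a Gaussian p-th moment and a square root give R^(-(p-2)/2).
  Bounding the velocity by a lower bound of its denominator would cost an exponential in |z|^2;
  linear growth survives only because numerator and denominator are compared under the same Gaussian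
  posterior. The coupling behind the truncation error is an arbitrary near-optimal one, so it has to
  be extended at both ends: by a function on the side of the flow, by a probability kernel on the
  side of the mollified law.\<close>

lemma gronwall_norm:
  fixes w w' :: "real \<Rightarrow> 'a::euclidean_space"
  assumes w: "\<And>t. t \<in> {0..1} \<Longrightarrow> (w has_vector_derivative w' t) (at t within {0..1})"
    and bound: "\<And>t. t \<in> {0..1} \<Longrightarrow> norm (w' t) \<le> L * norm (w t) + d"
    and "0 \<le> L" "0 \<le> d" and t: "t \<in> {0..1}"
  shows "norm (w t) \<le> (norm (w 0) + d) * exp L"
proof -
  have cw: "continuous_on {0..1} w"
    unfolding continuous_on_eq_continuous_within using w has_vector_derivative_continuous by blast
  define h where "h s = L * norm (w s) + d" for s
  have ch: "continuous_on {0..1} h" unfolding h_def by (intro continuous_intros cw)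
  \<comment> \<open>The norm of \<open>w\<close> need not be differentiable at zeros of
    \<open>w\<close>; the argument runs on this integral majorant, whose derivative is
    \<open>h\<close>.\<close>
  define g where "g s = norm (w 0) + integral {0..s} h" for s
  have g': "(g has_vector_derivative h s) (at s within {0..1})" if "s \<in> {0..1}" for s
    unfolding g_def using integral_has_vector_derivative[OF ch that]
    by (auto intro!: derivative_eq_intros)
  have wg: "norm (w s) \<le> g s" if s: "s \<in> {0..1}" for s
  proof -
    \<comment> \<open>For the gauge integral every derivative is integrable, so the fundamental
      theorem applies to \<open>w'\<close> itself.\<close>
    have "(w' has_integral (w s - w 0)) {0..s}"
      using s by (intro fundamental_theorem_of_calculus)
        (auto intro!: has_vector_derivative_within_subset[OF w])
    moreover have "h integrable_on {0..s}"
      using s by (intro integrable_continuous_real continuous_on_subset[OF ch]) auto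
    ultimately have "norm (w s - w 0) \<le> integral {0..s} h"
      using integral_norm_bound_integral[of w' "{0..s}" h] bound s
      by (simp add: has_integral_iff h_def)
    then show ?thesis unfolding g_def using norm_triangle_sub[of "w s" "w 0"] by simp
  qed
  \<comment> \<open>The integrating factor leaves at most \<open>d * exp (- L * s) \<le> d\<close>
    in the derivative, and \<open>d * s\<close> compensates it. This gives \<open>exp L\<close> in
    place of the sharper (exp L - 1) / L and covers \<open>L = 0\<close> without a case
    distinction.\<close>
  define k where "k s = exp (- L * s) * g s - d * s" for s
  have k': "(k has_real_derivative exp (- L * s) * (h s - L * g s) - d) (at s within {0..1})"
    if "s \<in> {0..1}" for s
    unfolding k_def using g'[OF that]
    by (auto intro!: derivative_eq_intros simp: has_real_derivative_iff_has_vector_derivative[symmetric]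
        algebra_simps)
  have neg: "exp (- L * s) * (h s - L * g s) - d \<le> 0" if s: "s \<in> {0..1}" for s
  proof -
    have "h s - L * g s \<le> d" using wg[OF s] \<open>0 \<le> L\<close> by (simp add: h_def mult_left_mono)
    then have "exp (- L * s) * (h s - L * g s) \<le> exp (- L * s) * d" by (simp add: mult_left_mono)
    also have "\<dots> \<le> 1 * d" using s \<open>0 \<le> L\<close> \<open>0 \<le> d\<close> by (intro mult_right_mono) auto
    finally show ?thesis by simp
  qed
  have "k t \<le> k 0"
  proof -
    have "((\<lambda>s. exp (- L * s) * (h s - L * g s) - d) has_integral (k t - k 0)) {0..t}"
    proof (rule fundamental_theorem_of_calculus)
      fix s assume "s \<in> {0..t}"
      then have "s \<in> {0..1}" using t by auto
      then show "(k has_vector_derivative exp (- L * s) * (h s - L * g s) - d) (at s within {0..t})"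
        using has_vector_derivative_within_subset[OF
            k'[unfolded has_real_derivative_iff_has_vector_derivative]] t by auto
    qed (use t in auto)
    then have "k t - k 0 \<le> 0"
    proof (rule has_integral_le)
      show "((\<lambda>s. 0) has_integral 0) {0..t}" by simp
      show "exp (- L * s) * (h s - L * g s) - d \<le> 0" if "s \<in> {0..t}" for s
        using neg[of s] that t by auto
    qed
    then show ?thesis by simp
  qed
  then have "exp (- L * t) * g t \<le> norm (w 0) + d * t" by (simp add: k_def g_def)
  then have "g t \<le> (norm (w 0) + d * t) * exp (L * t)"
    by (simp add: exp_minus field_simps)
  also have "\<dots> \<le> (norm (w 0) + d) * exp L"
    using t \<open>0 \<le> L\<close> \<open>0 \<le> d\<close> by (intro mult_mono add_left_mono) (auto simp: mult_left_le)
  finally show ?thesis using wg[OF t] by simp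
qed

text \<open>The condition under the description operator of \<open>terminal_map\<close>, with the
  end point left free. Values of \<open>X\<close> outside \<open>{0..1}\<close> are arbitrary, so
  flow lines are compared only on that interval.\<close>

definition flow_line :: "('a::real_normed_vector \<Rightarrow> real \<Rightarrow> 'a) \<Rightarrow> 'a \<Rightarrow> (real \<Rightarrow> 'a) \<Rightarrow> bool" where
  "flow_line v x X \<longleftrightarrow> X 0 = x \<and>
     (\<forall>t\<in>{0..1}. (X has_vector_derivative v (X t) t) (at t within {0..1}))"

lemma flow_line_cong:
  assumes "flow_line v x X" "\<And>t. t \<in> {0..1} \<Longrightarrow> w (X t) t = v (X t) t"
  shows "flow_line w x X"
  using assms by (auto simp: flow_line_def)

text \<open>Banach's fixed point theorem applies on all of \<open>[0, 1]\<close> at once because the unknown is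
  rescaled by \<open>exp (c t)\<close> with \<open>c\<close> larger than the Lipschitz constant.\<close>
lemma flow_line_exists_lipschitz:
  fixes v :: "'a::euclidean_space \<Rightarrow> real \<Rightarrow> 'a"
  assumes cont: "continuous_on (UNIV \<times> {0..1}) (\<lambda>(x, t). v x t)"
    and lip: "\<And>t. t \<in> {0..1} \<Longrightarrow> L-lipschitz_on UNIV (\<lambda>x. v x t)"
  shows "\<exists>X. flow_line v x X"
proof -
  have L: "0 \<le> L" using lip[of 0] by (simp add: lipschitz_on_nonneg)
  \<comment> \<open>Positive even for \<open>L = 0\<close>, and \<open>L / c\<close> stays below
    1/2.\<close>
  define c where "c = 2 * L + 1"
  have c: "0 < c" using L by (simp add: c_def)
  \<comment> \<open>Bounded continuous functions live on the whole line; clamping the time extends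
    the Picard image to it.\<close>
  define cl :: "real \<Rightarrow> real" where "cl t = max 0 (min 1 t)" for t
  have cl: "cl t \<in> {0..1}" for t by (simp add: cl_def)
  have clid: "t \<in> {0..1} \<Longrightarrow> cl t = t" for t by (simp add: cl_def)
  have ccl: "continuous_on UNIV cl" unfolding cl_def by (intro continuous_intros)
  define F where "F Z s = v (exp (c * s) *\<^sub>R apply_bcontfun Z s) s" for Z s
  have cF: "continuous_on {0..1} (F Z)" for Z
    unfolding F_def
    by (rule continuous_on_compose2[OF cont, of _ "\<lambda>s. (exp (c * s) *\<^sub>R apply_bcontfun Z s, s)", simplified])
      (auto intro!: continuous_intros)
  define H where "H Z t = exp (- c * t) *\<^sub>R (x + integral {0..t} (F Z))" for Z t
  have cH: "continuous_on {0..1} (H Z)" for Z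
    unfolding H_def
    by (intro continuous_intros indefinite_integral_continuous_1 integrable_continuous_real cF)
  have bc: "(\<lambda>t. H Z (cl t)) \<in> bcontfun" for Z
  proof -
    have "continuous_on UNIV (\<lambda>t. H Z (cl t))"
      by (rule continuous_on_compose2[OF cH ccl]) (use cl in auto)
    moreover have "bounded (range (\<lambda>t. H Z (cl t)))"
      by (rule bounded_subset[OF compact_imp_bounded[OF compact_continuous_image[OF cH compact_Icc]]])
        (use cl in auto)
    ultimately show ?thesis by (simp add: bcontfun_def)
  qed
  define \<Phi> where "\<Phi> Z = Bcontfun (\<lambda>t. H Z (cl t))" for Z
  have \<Phi>: "apply_bcontfun (\<Phi> Z) t = H Z (cl t)" for Z t
    unfolding \<Phi>_def by (simp add: Bcontfun_inverse[OF bc])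
  have contr: "dist (\<Phi> Z) (\<Phi> Z') \<le> (L / c) * dist Z Z'" for Z Z'
  proof (rule dist_bound)
    fix t
    define \<tau> where "\<tau> = cl t"
    have \<tau>: "\<tau> \<in> {0..1}" using cl by (simp add: \<tau>_def)
    define D where "D = dist Z Z'"
    have intF: "F Z integrable_on {0..\<tau>}" for Z
      using \<tau> by (intro integrable_continuous_real continuous_on_subset[OF cF]) auto
    \<comment> \<open>Integrating the weight produces the factor \<open>1 / c\<close> that makes the
      map a contraction.\<close>
    have g: "((\<lambda>s. L * exp (c * s) * D) has_integral (L / c * D * exp (c * \<tau>) - L / c * D * exp (c * 0))) {0..\<tau>}"
      using \<tau> c by (intro fundamental_theorem_of_calculus)
        (auto intro!: derivative_eq_intros simp: has_real_derivative_iff_has_vector_derivative[symmetric])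
    have "norm (integral {0..\<tau>} (\<lambda>s. F Z s - F Z' s)) \<le> integral {0..\<tau>} (\<lambda>s. L * exp (c * s) * D)"
    proof (rule integral_norm_bound_integral)
      show "(\<lambda>s. F Z s - F Z' s) integrable_on {0..\<tau>}" by (intro integrable_diff intF)
      show "(\<lambda>s. L * exp (c * s) * D) integrable_on {0..\<tau>}" using g by blast
      fix s assume "s \<in> {0..\<tau>}"
      then have s: "s \<in> {0..1}" using \<tau> by auto
      have "norm (F Z s - F Z' s) \<le> L * dist (exp (c * s) *\<^sub>R apply_bcontfun Z s) (exp (c * s) *\<^sub>R apply_bcontfun Z' s)"
        unfolding F_def dist_norm[symmetric] using lipschitz_onD[OF lip[OF s]] by auto
      also have "\<dots> = L * exp (c * s) * dist (apply_bcontfun Z s) (apply_bcontfun Z' s)"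
        by (simp add: dist_norm scaleR_diff_right[symmetric])
      also have "\<dots> \<le> L * exp (c * s) * D"
        unfolding D_def using L dist_bounded[of Z s Z'] by (intro mult_left_mono) auto
      finally show "norm (F Z s - F Z' s) \<le> L * exp (c * s) * D" .
    qed
    also have "\<dots> = L / c * D * (exp (c * \<tau>) - 1)" using g by (simp add: has_integral_iff algebra_simps)
    also have "\<dots> \<le> L / c * D * exp (c * \<tau>)"
      using L c by (intro mult_left_mono) (auto simp: D_def)
    finally have *: "norm (integral {0..\<tau>} (F Z) - integral {0..\<tau>} (F Z')) \<le> L / c * D * exp (c * \<tau>)"
      using intF by (simp add: integral_diff)
    have "dist (H Z \<tau>) (H Z' \<tau>) = exp (- c * \<tau>) * norm (integral {0..\<tau>} (F Z) - integral {0..\<tau>} (F Z'))"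
      by (simp add: H_def dist_norm scaleR_diff_right[symmetric])
    also have "\<dots> \<le> exp (- c * \<tau>) * (L / c * D * exp (c * \<tau>))" by (intro mult_left_mono *) auto
    also have "\<dots> = L / c * D" by (simp add: exp_minus)
    finally show "dist (apply_bcontfun (\<Phi> Z) t) (apply_bcontfun (\<Phi> Z') t) \<le> L / c * dist Z Z'"
      by (simp add: \<Phi> \<tau>_def D_def)
  qed
  have "\<exists>!Z. \<Phi> Z = Z"
    using banach_fix_type[of "L / c" \<Phi>] contr L by (auto simp: c_def)
  then obtain Z where Z: "\<Phi> Z = Z" by blast
  define X where "X t = exp (c * t) *\<^sub>R apply_bcontfun Z t" for t
  have XF: "F Z t = v (X t) t" for t by (simp add: F_def X_def)
  have X: "X t = x + integral {0..t} (F Z)" if "t \<in> {0..1}" for t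
  proof -
    have "apply_bcontfun Z t = H Z t" using \<Phi>[of Z t] that by (simp add: Z clid)
    then show ?thesis by (simp add: X_def H_def exp_minus)
  qed
  have "(X has_vector_derivative v (X t) t) (at t within {0..1})" if t: "t \<in> {0..1}" for t
  proof -
    have "((\<lambda>t. x + integral {0..t} (F Z)) has_vector_derivative F Z t) (at t within {0..1})"
      using integral_has_vector_derivative[OF cF t] by (auto intro!: derivative_eq_intros)
    then show ?thesis
      using t X XF by (auto intro: has_vector_derivative_transform)
  qed
  moreover have "X 0 = x" using X[of 0] by simp
  ultimately show ?thesis unfolding flow_line_def by blast
qed

text \<open>The difference of the velocities is split at \<open>w (X t) t\<close>: one part is the
  field error along \<open>X\<close>, the other uses the Lipschitz constant of \<open>w\<close>. So
  only the reference field contributes \<open>L\<close>, and \<open>v\<close> enters through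
  \<open>d\<close> alone.\<close>

lemma flow_line_stability:
  fixes v w :: "'a::euclidean_space \<Rightarrow> real \<Rightarrow> 'a"
  assumes X: "flow_line v x X" and Y: "flow_line w y Y"
    and lip: "\<And>t. t \<in> {0..1} \<Longrightarrow> L-lipschitz_on U (\<lambda>x. w x t)"
    and U: "\<And>t. t \<in> {0..1} \<Longrightarrow> X t \<in> U \<and> Y t \<in> U"
    and d: "\<And>t. t \<in> {0..1} \<Longrightarrow> norm (v (X t) t - w (X t) t) \<le> d"
    and t: "t \<in> {0..1}"
  shows "norm (X t - Y t) \<le> (norm (x - y) + d) * exp L"
proof -
  have L: "0 \<le> L" using lip[of 0] by (simp add: lipschitz_on_nonneg)
  have d0: "0 \<le> d" by (rule order_trans[OF norm_ge_zero d[OF t]])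
  have "norm (X t - Y t) \<le> (norm (X 0 - Y 0) + d) * exp L"
  proof (rule gronwall_norm[where w' = "\<lambda>t. v (X t) t - w (Y t) t"])
    fix s :: real assume s: "s \<in> {0..1}"
    show "((\<lambda>t. X t - Y t) has_vector_derivative v (X s) s - w (Y s) s) (at s within {0..1})"
      using X Y s unfolding flow_line_def by (intro has_vector_derivative_diff) auto
    have "norm (v (X s) s - w (Y s) s) \<le> norm (v (X s) s - w (X s) s) + norm (w (X s) s - w (Y s) s)"
      using norm_triangle_ineq[of "v (X s) s - w (X s) s" "w (X s) s - w (Y s) s"] by simp
    also have "\<dots> \<le> d + L * norm (X s - Y s)"
      using d[OF s] lipschitz_onD[OF lip[OF s], of "X s" "Y s"] U[OF s]
      unfolding dist_norm by (intro add_mono) blast+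
    finally show "norm (v (X s) s - w (Y s) s) \<le> L * norm (X s - Y s) + d" by simp
  qed (fact L d0 t)+
  moreover have "X 0 = x" "Y 0 = y" using X Y by (simp_all add: flow_line_def)
  ultimately show ?thesis by simp
qed

text \<open>Only the growth constant \<open>C\<close> is recorded, because it alone is uniform in
  the cutoff radius and in the learned field; the Lipschitz constants on balls give existence,
  uniqueness and continuity and leave no trace in the estimates.\<close>

definition growth_field :: "real \<Rightarrow> ('a::euclidean_space \<Rightarrow> real \<Rightarrow> 'a) \<Rightarrow> bool" where
  "growth_field C v \<longleftrightarrow> 0 \<le> C \<and> continuous_on (UNIV \<times> {0..1}) (\<lambda>(x, t). v x t) \<and>
     (\<forall>r. \<exists>L. \<forall>t\<in>{0..1}. L-lipschitz_on (cball 0 r) (\<lambda>x. v x t)) \<and>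
     (\<forall>x. \<forall>t\<in>{0..1}. norm (v x t) \<le> C * (1 + norm x))"

lemma growth_fieldI_local_lipschitz:
  fixes v :: "'a::euclidean_space \<Rightarrow> real \<Rightarrow> 'a"
  assumes cont: "continuous_on (UNIV \<times> {0..1}) (\<lambda>(x, t). v x t)"
    and lip: "local_lipschitz {0..1} UNIV (\<lambda>t x. v x t)"
    and b: "\<And>x t. t \<in> {0..1} \<Longrightarrow> norm (v x t) \<le> C * (1 + norm x)" and C: "0 \<le> C"
  shows "growth_field C v"
proof -
  have "\<exists>L. \<forall>t\<in>{0..1}. L-lipschitz_on (cball 0 r) (\<lambda>x. v x t)" for r
  proof -
    have c: "continuous_on {0..1} (\<lambda>t. v x t)" for x
      by (rule continuous_on_compose2[OF cont, of _ "\<lambda>t. (x, t)", simplified])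
        (auto intro!: continuous_intros)
    have l: "local_lipschitz {0..1} (cball 0 r) (\<lambda>t x. v x t)"
      by (rule local_lipschitz_subset[OF lip]) auto
    show ?thesis
      by (rule local_lipschitz_compact_implies_lipschitz[OF l compact_cball compact_Icc c]) blast
  qed
  then show ?thesis using cont b C by (simp add: growth_field_def)
qed

text \<open>The metric projection is nonexpansive, so composing a field with it turns a Lipschitz
  bound on the ball into a global one.\<close>

lemma closest_point_cball_0:
  fixes x :: "'a::euclidean_space"
  assumes "0 \<le> r"
  shows "closest_point (cball 0 r) x \<in> cball 0 r" "norm (closest_point (cball 0 r) x) \<le> norm x"
    "x \<in> cball 0 r \<Longrightarrow> closest_point (cball 0 r) x = x"
    "dist (closest_point (cball 0 r) x) (closest_point (cball 0 r) y) \<le> dist x y"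
proof -
  show "closest_point (cball 0 r) x \<in> cball 0 r" using assms by (intro closest_point_in_set) auto
  show "dist (closest_point (cball 0 r) x) (closest_point (cball 0 r) y) \<le> dist x y" for x y :: 'a
    using assms by (intro closest_point_lipschitz) auto
  from this[of x 0] show "norm (closest_point (cball 0 r) x) \<le> norm x"
    using assms by (simp add: closest_point_self)
qed (simp add: closest_point_self)

text \<open>Comparison with the radial point shows that the projection moves an outside point by at
  most \<open>norm y - r\<close>; its image therefore still has norm at least \<open>r\<close>,
  where \<open>f\<close> vanishes too. Thus a cut off field does not notice the projection.\<close>

lemma closest_point_cball_0_supported:
  fixes f :: "'a::euclidean_space \<Rightarrow> 'b::zero"
  assumes r: "0 \<le> r" and f: "\<And>y. r \<le> norm y \<Longrightarrow> f y = 0"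
  shows "f (closest_point (cball 0 r) y) = f y"
proof (cases "norm y \<le> r")
  case True
  then show ?thesis using closest_point_cball_0(3)[OF r, of y] by simp
next
  case False
  have "dist y (closest_point (cball 0 r) y) \<le> dist y ((r / norm y) *\<^sub>R y)"
    using r False by (intro closest_point_le) auto
  also have "\<dots> = norm y - r"
  proof -
    have "y - (r / norm y) *\<^sub>R y = ((norm y - r) / norm y) *\<^sub>R y"
      using False r by (auto simp: scaleR_diff_left diff_divide_distrib)
    moreover have "y \<noteq> 0" using False r by auto
    ultimately show ?thesis using False r by (simp add: dist_norm)
  qed
  finally have "r \<le> norm (closest_point (cball 0 r) y)"
    using norm_triangle_sub[of y "closest_point (cball 0 r) y"] by (simp add: dist_norm)
  then show ?thesis using f False by simp
qed

section \<open>Existence, uniqueness and time reversal of flow lines under linear growth\<close>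

context
  fixes C :: real and v :: "'a::euclidean_space \<Rightarrow> real \<Rightarrow> 'a"
  assumes v: "growth_field C v"
begin

lemma flow_line_bound:
  assumes X: "flow_line v x X" and t: "t \<in> {0..1}"
  shows "norm (X t) \<le> (norm x + C) * exp C"
proof -
  have "norm (X t) \<le> (norm (X 0) + C) * exp C"
    using X v t by (intro gronwall_norm[of X "\<lambda>t. v (X t) t"])
      (auto simp: flow_line_def growth_field_def algebra_simps)
  then show ?thesis using X by (simp add: flow_line_def)
qed

text \<open>Projecting does not increase the norm, so \<open>C\<close> is kept while the Lipschitz
  constant becomes global.\<close>

lemma truncated_field:
  assumes r: "0 \<le> r"
  obtains L where "growth_field C (\<lambda>x. v (closest_point (cball 0 r) x))"
    "\<And>t. t \<in> {0..1} \<Longrightarrow> L-lipschitz_on UNIV (\<lambda>x. v (closest_point (cball 0 r) x) t)"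
proof -
  obtain L where L: "\<And>t. t \<in> {0..1} \<Longrightarrow> L-lipschitz_on (cball 0 r) (\<lambda>x. v x t)"
    using v unfolding growth_field_def by meson
  have L0: "0 \<le> L" using L[of 0] by (simp add: lipschitz_on_nonneg)
  note P = closest_point_cball_0[OF r]
  have lip: "L-lipschitz_on UNIV (\<lambda>x. v (closest_point (cball 0 r) x) t)" if "t \<in> {0..1}" for t
  proof (rule lipschitz_onI)
    fix x y
    have "dist (v (closest_point (cball 0 r) x) t) (v (closest_point (cball 0 r) y) t)
      \<le> L * dist (closest_point (cball 0 r) x) (closest_point (cball 0 r) y)"
      using lipschitz_onD[OF L[OF that]] P(1) by blast
    also have "\<dots> \<le> L * dist x y" by (intro mult_left_mono P L0)
    finally show "dist (v (closest_point (cball 0 r) x) t) (v (closest_point (cball 0 r) y) t)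
      \<le> L * dist x y" .
  qed (rule L0)
  have cv: "continuous_on (UNIV \<times> {0..1}) (\<lambda>(x, t). v x t)" using v by (simp add: growth_field_def)
  have cp: "continuous_on UNIV (closest_point (cball (0::'a) r))"
    using r by (intro continuous_on_closest_point) auto
  have "continuous_on (UNIV \<times> {0..1}) (\<lambda>z. v (closest_point (cball 0 r) (fst z)) (snd z))"
    by (rule continuous_on_compose2[OF cv,
          of _ "\<lambda>z. (closest_point (cball 0 r) (fst z), snd z)", simplified])
      (auto intro!: continuous_intros continuous_on_compose2[OF cp])
  moreover have "norm (v (closest_point (cball 0 r) x) t) \<le> C * (1 + norm x)" if "t \<in> {0..1}" for x t
  proof -
    have "norm (v (closest_point (cball 0 r) x) t) \<le> C * (1 + norm (closest_point (cball 0 r) x))"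
      using v that by (simp add: growth_field_def)
    also have "\<dots> \<le> C * (1 + norm x)" using v P(2)
      by (intro mult_left_mono add_left_mono) (auto simp: growth_field_def)
    finally show ?thesis .
  qed
  moreover have "\<exists>L. \<forall>t\<in>{0..1}. L-lipschitz_on (cball 0 r') (\<lambda>x. v (closest_point (cball 0 r) x) t)" for r'
    using lip lipschitz_on_subset by blast
  ultimately have "growth_field C (\<lambda>x. v (closest_point (cball 0 r) x))"
    using v by (simp add: growth_field_def case_prod_unfold)
  with lip that show thesis by blast
qed

text \<open>The a priori bound depends only on \<open>C\<close>, which truncation preserves. With
  this bound as truncation radius, the solution of the truncated equation never leaves the ball on
  which the two fields agree.\<close>

lemma flow_line_exists: "\<exists>X. flow_line v x X"
proof -
  have C: "0 \<le> C" using v by (simp add: growth_field_def)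
  define r where "r = (norm x + C) * exp C"
  have r: "0 \<le> r" using C by (simp add: r_def)
  obtain L where g: "growth_field C (\<lambda>x. v (closest_point (cball 0 r) x))"
    and l: "\<And>t. t \<in> {0..1} \<Longrightarrow> L-lipschitz_on UNIV (\<lambda>x. v (closest_point (cball 0 r) x) t)"
    using truncated_field[OF r] by metis
  obtain X where X: "flow_line (\<lambda>x. v (closest_point (cball 0 r) x)) x X"
    using flow_line_exists_lipschitz[where v = "\<lambda>x. v (closest_point (cball 0 r) x)", OF _ l] g
    unfolding growth_field_def by blast
  have "norm (X t) \<le> r" if "t \<in> {0..1}" for t
    using gronwall_norm[of X "\<lambda>t. v (closest_point (cball 0 r) (X t)) t" C C t] X g that
    by (auto simp: flow_line_def growth_field_def algebra_simps r_def)
  then have "flow_line v x X"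
    by (intro flow_line_cong[OF X]) (simp add: closest_point_self)
  then show ?thesis by blast
qed

text \<open>Both trajectories stay in one ball, on which a single Lipschitz constant is available.
  Equal starting points give uniqueness; the general case gives continuity, hence measurability, of
  the terminal map.\<close>

lemma flow_line_lipschitz_initial:
  assumes "0 \<le> r"
  shows "\<exists>K\<ge>0. \<forall>x y X Y. \<forall>t\<in>{0..1}. flow_line v x X \<longrightarrow> flow_line v y Y \<longrightarrow>
    norm x \<le> r \<longrightarrow> norm y \<le> r \<longrightarrow> norm (X t - Y t) \<le> K * norm (x - y)"
proof -
  have C: "0 \<le> C" using v by (simp add: growth_field_def)
  define s where "s = (r + C) * exp C"
  have s: "0 \<le> s" using C assms by (simp add: s_def)
  obtain L where L: "\<And>t. t \<in> {0..1} \<Longrightarrow> L-lipschitz_on (cball 0 s) (\<lambda>x. v x t)"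
    using v unfolding growth_field_def by meson
  have b: "X t \<in> cball 0 s" if "flow_line v x X" "norm x \<le> r" "t \<in> {0..1}" for x X t
  proof -
    have "(norm x + C) * exp C \<le> s" unfolding s_def using that by (intro mult_right_mono) auto
    then show ?thesis using flow_line_bound[OF that(1,3)] by simp
  qed
  have "norm (X t - Y t) \<le> exp L * norm (x - y)"
    if *: "flow_line v x X" "flow_line v y Y" "norm x \<le> r" "norm y \<le> r" "t \<in> {0..1}" for x y X Y t
  proof -
    have "norm (X t - Y t) \<le> (norm (x - y) + 0) * exp L"
      by (rule flow_line_stability[OF *(1,2) L]) (use * b in auto)
    then show ?thesis by (simp add: mult.commute)
  qed
  then show ?thesis by (intro exI[of _ "exp L"]) auto
qed

lemma flow_line_unique:
  assumes "flow_line v x X" "flow_line v x Y" "t \<in> {0..1}"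
  shows "X t = Y t"
proof -
  obtain K where "norm (X t - Y t) \<le> K * norm (x - x)"
    using flow_line_lipschitz_initial[OF norm_ge_zero[of x]] assms by blast
  then show ?thesis by simp
qed

lemma reversed_growth_field: "growth_field C (\<lambda>x t. - v x (1 - t))"
proof -
  have "continuous_on (UNIV \<times> {0..1}) (\<lambda>z. - v (fst z) (1 - snd z))"
  proof (intro continuous_intros)
    have "continuous_on (UNIV \<times> {0..1}) (\<lambda>(x, t). v x t)" using v by (simp add: growth_field_def)
    show "continuous_on (UNIV \<times> {0..1}) (\<lambda>z. v (fst z) (1 - snd z))"
      by (rule continuous_on_compose2[OF \<open>continuous_on _ (\<lambda>(x, t). v x t)\<close>,
            of _ "\<lambda>z. (fst z, 1 - snd z)", simplified])
        (auto intro!: continuous_intros)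
  qed
  moreover have "\<exists>L. \<forall>t\<in>{0..1}. L-lipschitz_on (cball 0 r) (\<lambda>x. - v x (1 - t))" for r
  proof -
    obtain L where L: "\<forall>t\<in>{0..1}. L-lipschitz_on (cball 0 r) (\<lambda>x. v x t)"
      using v unfolding growth_field_def by meson
    have "L-lipschitz_on (cball 0 r) (\<lambda>x. - v x (1 - t))" if "t \<in> {0..1}" for t
      using L[rule_format, of "1 - t"] that by (intro lipschitz_on_minus) auto
    then show ?thesis by blast
  qed
  ultimately show ?thesis using v by (simp add: growth_field_def case_prod_unfold)
qed

lemma flow_line_reverse:
  assumes X: "flow_line v x X"
  shows "flow_line (\<lambda>x t. - v x (1 - t)) (X 1) (\<lambda>t. X (1 - t))"
proof -
  have "((\<lambda>t. X (1 - t)) has_vector_derivative - v (X (1 - t)) (1 - t)) (at t within {0..1})"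
    if t: "t \<in> {0..1}" for t
  proof -
    have i: "(\<lambda>t::real. 1 - t) ` {0..1} = {0..1}" by (auto simp: image_def intro!: bexI[of _ "1 - _"])
    have "((X \<circ> (\<lambda>t. 1 - t)) has_vector_derivative (-1) *\<^sub>R v (X (1 - t)) (1 - t)) (at t within {0..1})"
      by (rule vector_diff_chain_within)
        (use X t i in \<open>auto simp: flow_line_def intro!: derivative_eq_intros\<close>)
    then show ?thesis by (simp add: o_def)
  qed
  then show ?thesis by (auto simp: flow_line_def)
qed

end

section \<open>The terminal map: well-definedness, growth, continuity, inversion and
  stability\<close>

lemma terminal_map_eq:
  fixes v :: "real^'d::finite \<Rightarrow> real \<Rightarrow> real^'d"
  assumes v: "growth_field C v" and X: "flow_line v x X"
  shows "terminal_map v x = X 1"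
  unfolding terminal_map_def flow_line_def[symmetric]
proof (rule the_equality)
  show "\<exists>X'. X' 0 = x \<and> X' 1 = X 1 \<and>
    (\<forall>t\<in>{0..1}. (X' has_vector_derivative v (X' t) t) (at t within {0..1}))"
    using X unfolding flow_line_def by blast
next
  fix y assume "\<exists>X. X 0 = x \<and> X 1 = y \<and>
    (\<forall>t\<in>{0..1}. (X has_vector_derivative v (X t) t) (at t within {0..1}))"
  then obtain Y where "flow_line v x Y" "Y 1 = y" unfolding flow_line_def by blast
  then show "y = X 1" using flow_line_unique[OF v X, of Y 1] by simp
qed

lemma terminal_map_bound:
  fixes v :: "real^'d::finite \<Rightarrow> real \<Rightarrow> real^'d"
  assumes v: "growth_field C v"
  shows "norm (terminal_map v x) \<le> (norm x + C) * exp C"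
  proof -
  obtain X where X: "flow_line v x X" using flow_line_exists[OF v] by blast
  show ?thesis using flow_line_bound[OF v X, of 1] terminal_map_eq[OF v X] by simp
qed

lemma continuous_on_terminal_map:
  fixes v :: "real^'d::finite \<Rightarrow> real \<Rightarrow> real^'d"
  assumes v: "growth_field C v"
  shows "continuous_on UNIV (terminal_map v)"
proof -
  have "isCont (terminal_map v) x" for x
  proof -
    have "0 \<le> norm x + 1" by simp
    from flow_line_lipschitz_initial[OF v this] obtain K where K: "0 \<le> K"
      "\<And>y z Y Z t. flow_line v y Y \<Longrightarrow> flow_line v z Z \<Longrightarrow> norm y \<le> norm x + 1
      \<Longrightarrow> norm z \<le> norm x + 1 \<Longrightarrow> t \<in> {0..1} \<Longrightarrow> norm (Y t - Z t) \<le> K * norm (y - z)"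
      by blast
    have "K-lipschitz_on (cball 0 (norm x + 1)) (terminal_map v)"
    proof (rule lipschitz_onI)
      fix y z :: "real^'d" assume *: "y \<in> cball 0 (norm x + 1)" "z \<in> cball 0 (norm x + 1)"
      obtain Y Z where Y: "flow_line v y Y" and Z: "flow_line v z Z" using flow_line_exists[OF v] by blast
      show "dist (terminal_map v y) (terminal_map v z) \<le> K * dist y z"
        using K(2)[OF Y Z, of 1] * by (simp add: terminal_map_eq[OF v Y] terminal_map_eq[OF v Z] dist_norm)
    qed (rule K(1))
    then have "continuous_on (cball 0 (norm x + 1)) (terminal_map v)" by (rule lipschitz_on_continuous_on)
    then show ?thesis by (rule continuous_on_interior) simp
  qed
  then show ?thesis by (simp add: continuous_at_imp_continuous_on)
qed

lemma terminal_map_reversed: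
  fixes v :: "real^'d::finite \<Rightarrow> real \<Rightarrow> real^'d"
  assumes v: "growth_field C v"
  shows "terminal_map (\<lambda>x t. - v x (1 - t)) (terminal_map v x) = x"
proof -
  obtain X where X: "flow_line v x X" using flow_line_exists[OF v] by blast
  show ?thesis
    using terminal_map_eq[OF reversed_growth_field[OF v] flow_line_reverse[OF v X]] X
    by (simp add: terminal_map_eq[OF v X] flow_line_def)
qed

text \<open>Composing \<open>v\<close> with the projection onto the ball of radius \<open>R\<close> makes the comparison with
  \<open>w\<close> hold globally, so that no exit time is needed.\<close>
lemma terminal_map_stability:
  fixes v w :: "real^'d::finite \<Rightarrow> real \<Rightarrow> real^'d"
  assumes v: "growth_field C v" and w: "growth_field D w" and r: "0 \<le> r" and e: "d * exp L \<le> r"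
    and lip: "\<And>t. t \<in> {0..1} \<Longrightarrow> L-lipschitz_on UNIV (\<lambda>x. w x t)"
    and supp: "\<And>x t. 2 * r \<le> norm x \<Longrightarrow> t \<in> {0..1} \<Longrightarrow> w x t = 0"
    and d: "\<And>x t. norm x \<le> 2 * r \<Longrightarrow> t \<in> {0..1} \<Longrightarrow> norm (v x t - w x t) \<le> d"
    and x: "(norm x + D) * exp D \<le> r"
  shows "norm (terminal_map v x - terminal_map w x) \<le> d * exp L"
proof -
  have r2: "0 \<le> 2 * r" using r by simp
  note P = closest_point_cball_0[OF r2]
  \<comment> \<open>Radius \<open>2 * r\<close> leaves \<open>r\<close> for the reference trajectory
    and \<open>r\<close> for the deviation, and is the ball on which the error bound
    \<open>d\<close> is available.\<close>
  let ?P = "closest_point (cball 0 (2 * r))"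
  have wP: "w (?P y) t = w y t" if t: "t \<in> {0..1}" for y t
    using closest_point_cball_0_supported[OF r2, of "\<lambda>y. w y t"] supp t by blast
  have "growth_field C (\<lambda>x. v (?P x))" by (rule truncated_field[OF v r2])
  then obtain X where X: "flow_line (\<lambda>x. v (?P x)) x X" using flow_line_exists by blast
  obtain Y where Y: "flow_line w x Y" using flow_line_exists[OF w] by blast
  have XY: "norm (X t - Y t) \<le> d * exp L" if t: "t \<in> {0..1}" for t
  proof -
    \<comment> \<open>\<open>w\<close> may be evaluated at the projected point as well, since it
      vanishes beyond \<open>2 * r\<close>; so \<open>d\<close> applies wherever \<open>X s\<close>
      is.\<close>
    have "norm (v (?P (X s)) s - w (X s) s) \<le> d" if s: "s \<in> {0..1}" for s
      using d[of "?P (X s)" s] P(1)[of "X s"] s wP[OF s, of "X s"] by simp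
    from flow_line_stability[OF X Y lip _ this t] show ?thesis by simp
  qed
  \<comment> \<open>The reference trajectory has norm at most \<open>r\<close> and the deviation is
    at most \<open>r\<close>: the projection is never active, and \<open>X\<close> solves the
    original equation.\<close>
  have "norm (X t) \<le> 2 * r" if t: "t \<in> {0..1}" for t
    using XY[OF t] flow_line_bound[OF w Y t] x e norm_triangle_sub[of "X t" "Y t"] by linarith
  then have "flow_line v x X" by (intro flow_line_cong[OF X]) (simp add: P(3))
  then show ?thesis using XY[of 1] terminal_map_eq[OF v] terminal_map_eq[OF w Y] by simp
qed

section \<open>Gaussian measures\<close>

lemma nn_integral_lborel_shift:
  fixes f :: "'a::euclidean_space \<Rightarrow> ennreal"
  assumes [measurable]: "f \<in> borel_measurable borel"
  shows "(\<integral>\<^sup>+x. f (x - c) \<partial>lborel) = (\<integral>\<^sup>+x. f x \<partial>lborel)"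
proof -
  have "(\<integral>\<^sup>+x. f x \<partial>lborel) = (\<integral>\<^sup>+x. f x \<partial>distr lborel borel ((+) (- c)))"
    by (simp add: lborel_distr_plus)
  also have "\<dots> = (\<integral>\<^sup>+x. f (x - c) \<partial>lborel)" by (subst nn_integral_distr) auto
  finally show ?thesis ..
qed

section \<open>Normalisation and moments of the Gaussian density\<close>

lemma borel_measurable_gauss_density [measurable]: "gauss_density s \<in> borel_measurable borel"
  unfolding gauss_density_def by measurable

lemma gauss_density_nonneg [simp]: "0 \<le> gauss_density s u"
  by (simp add: gauss_density_def)

lemma power2_norm_eq_sum_Basis: "(norm x)\<^sup>2 = (\<Sum>b\<in>Basis. (x \<bullet> b)\<^sup>2)"
  unfolding power2_norm_eq_inner euclidean_inner[of x x] by (simp add: power2_eq_square)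

text \<open>Reduces integrals over the space to products of one-dimensional normal
  integrals.\<close>

lemma gauss_density_eq_prod:
  fixes u :: "real^'d::finite"
  assumes s: "0 < s"
  shows "gauss_density s u = (\<Prod>b\<in>Basis. normal_density 0 (sqrt s) (u \<bullet> b))"
proof -
  have "normal_density 0 (sqrt s) x = (2 * pi * s) powr (- 1 / 2) * exp (- x\<^sup>2 / (2 * s))" for x
  proof -
    have "(2 * pi * s) powr (- 1 / 2) = inverse (sqrt (2 * pi * s))"
      using s by (subst powr_half_sqrt[symmetric]) (simp_all add: powr_minus[symmetric])
    then show ?thesis using s by (simp add: normal_density_def inverse_eq_divide)
  qed
  then have "(\<Prod>b\<in>(Basis :: (real^'d) set). normal_density 0 (sqrt s) (u \<bullet> b))
      = ((2 * pi * s) powr (- 1 / 2)) ^ CARD('d) * exp (\<Sum>b\<in>Basis. - (u \<bullet> b)\<^sup>2 / (2 * s))"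
    by (simp only: prod.distrib prod_constant exp_sum finite_Basis DIM_cart DIM_real mult_1_right)
  also have "((2 * pi * s) powr (- 1 / 2)) ^ CARD('d) = (2 * pi * s) powr (- real CARD('d) / 2)"
    using s by (subst powr_realpow[symmetric]) (simp_all add: powr_powr)
  also have "(\<Sum>b\<in>Basis. - (u \<bullet> b)\<^sup>2 / (2 * s)) = - (norm u)\<^sup>2 / (2 * s)"
    unfolding power2_norm_eq_sum_Basis by (simp add: sum_divide_distrib sum_negf)
  finally show ?thesis by (simp add: gauss_density_def)
qed

lemma nn_integral_normal_density:
  assumes "0 < \<sigma>"
  shows "(\<integral>\<^sup>+x. ennreal (normal_density m \<sigma> x) \<partial>lborel) = 1"
  using assms by (subst nn_integral_eq_integral) auto

lemma nn_integral_gauss_density: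
  assumes s: "0 < s"
  shows "(\<integral>\<^sup>+u. ennreal (gauss_density s (u :: real^'d::finite)) \<partial>lborel) = 1"
proof -
  have "(\<integral>\<^sup>+u. ennreal (gauss_density s (u :: real^'d)) \<partial>lborel)
      = (\<integral>\<^sup>+u. (\<Prod>b\<in>Basis. ennreal (normal_density 0 (sqrt s) ((u :: real^'d) \<bullet> b))) \<partial>lborel)"
    by (simp add: gauss_density_eq_prod[OF s] prod_ennreal)
  also have "\<dots> = 1"
    using s by (subst nn_integral_lborel_prod) (auto simp: nn_integral_normal_density)
  finally show ?thesis .
qed

lemma sets_gauss [measurable_cong, simp]: "sets (gauss s) = sets borel"
  and space_gauss [simp]: "space (gauss s) = UNIV"
  by (simp_all add: gauss_def)

lemma prob_space_gauss: "0 < s \<Longrightarrow> prob_space (gauss s)"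
  by (rule prob_spaceI) (simp add: gauss_def emeasure_density nn_integral_gauss_density)

lemma nn_integral_gauss:
  "f \<in> borel_measurable borel \<Longrightarrow>
    (\<integral>\<^sup>+x. f x \<partial>gauss s) = (\<integral>\<^sup>+x. ennreal (gauss_density s x) * f x \<partial>lborel)"
  unfolding gauss_def by (subst nn_integral_density) auto

text \<open>Each coordinate contributes the variance \<open>s\<close>. With
  \<open>s = \<alpha>\<close> this is the mean squared mollifying noise, the origin of the term
  sqrt(\<alpha> d).\<close>

lemma gauss_second_moment:
  assumes s: "0 < s"
  shows "(\<integral>\<^sup>+u. ennreal (gauss_density s (u :: real^'d::finite) * (norm u)\<^sup>2) \<partial>lborel)
    = ennreal (s * real CARD('d))"
proof -
  let ?n = "normal_density 0 (sqrt s)"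
  have "(\<integral>\<^sup>+u. ennreal (gauss_density s (u :: real^'d) * (norm u)\<^sup>2) \<partial>lborel)
      = (\<integral>\<^sup>+u. (\<Sum>b\<in>Basis. ennreal (gauss_density s (u :: real^'d) * (u \<bullet> b)\<^sup>2)) \<partial>lborel)"
  proof (rule nn_integral_cong)
    fix u :: "real^'d"
    have "gauss_density s u * (norm u)\<^sup>2 = (\<Sum>b\<in>Basis. gauss_density s u * (u \<bullet> b)\<^sup>2)"
      by (simp only: power2_norm_eq_sum_Basis sum_distrib_left)
    then show "ennreal (gauss_density s u * (norm u)\<^sup>2)
        = (\<Sum>b\<in>Basis. ennreal (gauss_density s u * (u \<bullet> b)\<^sup>2))"
      by (simp only: sum_ennreal[symmetric] mult_nonneg_nonneg zero_le_power2 gauss_density_nonneg)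
  qed
  also have "\<dots> = (\<Sum>b\<in>Basis. \<integral>\<^sup>+u. ennreal (gauss_density s (u :: real^'d) * (u \<bullet> b)\<^sup>2) \<partial>lborel)"
    by (intro nn_integral_sum) measurable
  also have "\<dots> = (\<Sum>b\<in>(Basis :: (real^'d) set). ennreal s)"
  proof (rule sum.cong[OF refl])
    fix b :: "real^'d" assume b: "b \<in> Basis"
    \<comment> \<open>The square is attached to the factor of the coordinate \<open>b\<close> only,
      so that the integrand stays a product: one factor integrates to \<open>s\<close>, the others
      to 1.\<close>
    define f where "f c x = ?n x * (if c = b then x\<^sup>2 else 1)" for c :: "real^'d" and x :: real
    have f: "gauss_density s u * (u \<bullet> b)\<^sup>2 = (\<Prod>c\<in>Basis. f c (u \<bullet> c))" for u
      using b by (simp add: gauss_density_eq_prod[OF s] f_def prod.distrib)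
    have b2: "(\<integral>\<^sup>+x. ennreal (?n x * x\<^sup>2) \<partial>lborel) = ennreal s"
    proof -
      have "has_bochner_integral lborel (\<lambda>x. ?n x * x\<^sup>2) s"
        using normal_moment_even[of "sqrt s" 0 1] s by (simp add: fact_2)
      then show ?thesis
        by (subst nn_integral_eq_integral) (auto simp: has_bochner_integral_iff)
    qed
    have "(\<integral>\<^sup>+u. ennreal (gauss_density s u * (u \<bullet> b)\<^sup>2) \<partial>lborel)
        = (\<integral>\<^sup>+u. (\<Prod>c\<in>Basis. ennreal (f c (u \<bullet> c))) \<partial>lborel)"
      unfolding f by (subst prod_ennreal) (auto simp: f_def)
    also have "\<dots> = (\<Prod>c\<in>Basis. \<integral>\<^sup>+x. ennreal (f c x) \<partial>lborel)"
      by (rule nn_integral_lborel_prod) (auto simp: f_def)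
    also have "\<dots> = (\<Prod>c\<in>Basis. if c = b then ennreal s else 1)"
      using s by (intro prod.cong refl) (auto simp: f_def b2 nn_integral_normal_density)
    also have "\<dots> = ennreal s" using b by (simp add: prod.delta)
    finally show "(\<integral>\<^sup>+u. ennreal (gauss_density s u * (u \<bullet> b)\<^sup>2) \<partial>lborel) = ennreal s" .
  qed
  also have "\<dots> = ennreal (s * real CARD('d))"
    using s by (simp add: ennreal_of_nat_eq_real_of_nat ennreal_mult' mult.commute)
  finally show ?thesis .
qed

text \<open>From |x| \<le> |m| + 1 + |x - m|^2 the second moment suffices; what matters later is
  only that the bound is affine in \<open>norm m\<close>.\<close>

lemma gauss_abs_moment_shifted:
  fixes m :: "real^'d::finite"
  assumes s: "0 < s"
  shows "(\<integral>\<^sup>+x. ennreal (gauss_density s (x - m) * norm x) \<partial>lborel)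
    \<le> ennreal (1 + norm m + s * real CARD('d))"
proof -
  have "(\<integral>\<^sup>+x. ennreal (gauss_density s (x - m) * norm x) \<partial>lborel)
      \<le> (\<integral>\<^sup>+x. ennreal (gauss_density s (x - m) * (1 + norm m) + gauss_density s (x - m) * (norm (x - m))\<^sup>2) \<partial>lborel)"
  proof (intro nn_integral_mono ennreal_leI)
    fix x :: "real^'d"
    have "norm x \<le> norm m + norm (x - m)" using norm_triangle_sub[of x m] by simp
    moreover have "norm (x - m) \<le> 1 + (norm (x - m))\<^sup>2"
      using zero_le_power2[of "norm (x - m) - 1 / 2"] by (simp add: power2_eq_square algebra_simps)
    ultimately have "norm x \<le> (1 + norm m) + (norm (x - m))\<^sup>2" by linarith
    then show "gauss_density s (x - m) * norm x
      \<le> gauss_density s (x - m) * (1 + norm m) + gauss_density s (x - m) * (norm (x - m))\<^sup>2"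
      unfolding distrib_left[symmetric] by (rule mult_left_mono) simp
  qed
  also have "\<dots> = (\<integral>\<^sup>+x. ennreal (gauss_density s (x - m)) * ennreal (1 + norm m)
      + ennreal (gauss_density s (x - m) * (norm (x - m))\<^sup>2) \<partial>lborel)"
    by (intro nn_integral_cong) (simp add: ennreal_plus ennreal_mult')
  also have "\<dots> = (\<integral>\<^sup>+x. ennreal (gauss_density s (x - m)) \<partial>lborel) * ennreal (1 + norm m)
      + (\<integral>\<^sup>+x. ennreal (gauss_density s (x - m) * (norm (x - m))\<^sup>2) \<partial>lborel)"
    by (subst nn_integral_add) (auto simp: nn_integral_multc)
  also have "\<dots> = 1 * ennreal (1 + norm m) + ennreal (s * real CARD('d))"
    using s by (simp add: nn_integral_lborel_shift[of "\<lambda>x. ennreal (gauss_density s x)"]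
        nn_integral_lborel_shift[of "\<lambda>x. ennreal (gauss_density s x * (norm x)\<^sup>2)"]
        nn_integral_gauss_density gauss_second_moment)
  also have "\<dots> = ennreal (1 + norm m + s * real CARD('d))"
    using s by (simp add: ennreal_plus[symmetric] del: ennreal_plus)
  finally show ?thesis .
qed

text \<open>The power is absorbed by half of the Gaussian exponent, leaving a multiple of the
  density of variance \<open>2 * s\<close>.\<close>

lemma gauss_powr_moment_finite:
  assumes s: "0 < s" and p: "0 \<le> p"
  shows "(\<integral>\<^sup>+x. ennreal ((1 + norm x) powr p) \<partial>(gauss s :: (real^'d::finite) measure)) < \<infinity>"
proof -
  \<comment> \<open>The exponential is the constant term in p n \<le> p^2 s + n^2 / (4 s); the power
    of 2 is the quotient of the normalising constants for \<open>s\<close> and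
    \<open>2 * s\<close>.\<close>
  define c where "c = exp (p\<^sup>2 * s) * 2 powr (real CARD('d) / 2)"
  have le: "gauss_density s x * (1 + norm x) powr p \<le> c * gauss_density (2 * s) x" for x :: "real^'d"
  proof -
    define n where "n = norm x"
    have n: "0 \<le> n" by (simp add: n_def)
    have "ln (1 + n) \<le> n" using n by (simp add: ln_add_one_self_le_self)
    then have "(1 + n) powr p \<le> exp (p * n)" using n p by (simp add: powr_def mult_left_mono)
    also have "p * n \<le> p\<^sup>2 * s + n\<^sup>2 / (4 * s)"
    proof -
      have "0 \<le> (2 * s * p - n)\<^sup>2 / (4 * s)" using s by simp
      also have "\<dots> = p\<^sup>2 * s + n\<^sup>2 / (4 * s) - p * n"
        using s by (simp add: field_simps power2_eq_square)
      finally show ?thesis by simp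
    qed
    finally have 1: "(1 + n) powr p \<le> exp (p\<^sup>2 * s + n\<^sup>2 / (4 * s))" by simp
    have "gauss_density s x * (1 + n) powr p \<le> gauss_density s x * exp (p\<^sup>2 * s + n\<^sup>2 / (4 * s))"
      by (intro mult_left_mono 1) simp
    also have "\<dots> = (2 * pi * s) powr (- real CARD('d) / 2) * exp (p\<^sup>2 * s)
        * (exp (- n\<^sup>2 / (2 * s)) * exp (n\<^sup>2 / (4 * s)))"
      by (simp add: gauss_density_def exp_add n_def)
    also have "exp (- n\<^sup>2 / (2 * s)) * exp (n\<^sup>2 / (4 * s)) = exp (- n\<^sup>2 / (2 * (2 * s)))"
      using s by (simp add: exp_add[symmetric] field_simps)
    also have "(2 * pi * s) powr (- real CARD('d) / 2)
        = 2 powr (real CARD('d) / 2) * (2 * pi * (2 * s)) powr (- real CARD('d) / 2)"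
    proof -
      have "(2 * pi * (2 * s)) powr (- real CARD('d) / 2)
          = 2 powr (- real CARD('d) / 2) * (2 * pi * s) powr (- real CARD('d) / 2)"
        using s by (subst powr_mult[symmetric]) (auto simp: mult_ac)
      then show ?thesis by (simp add: powr_add[symmetric] mult.assoc[symmetric])
    qed
    finally show ?thesis by (simp add: c_def gauss_density_def n_def mult_ac)
  qed
  have "(\<integral>\<^sup>+x. ennreal ((1 + norm x) powr p) \<partial>(gauss s :: (real^'d) measure))
      = (\<integral>\<^sup>+x. ennreal (gauss_density s x * (1 + norm x) powr p) \<partial>(lborel :: (real^'d) measure))"
    by (simp add: nn_integral_gauss ennreal_mult')
  also have "\<dots> \<le> (\<integral>\<^sup>+x. ennreal c * ennreal (gauss_density (2 * s) x) \<partial>(lborel :: (real^'d) measure))"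
    using le by (intro nn_integral_mono) (simp add: ennreal_mult'[symmetric] c_def ennreal_leI)
  also have "\<dots> = ennreal c"
    using s by (simp add: nn_integral_cmult nn_integral_gauss_density)
  finally show ?thesis by (simp add: order_le_less_trans)
qed

lemma gauss_density_le:
  "0 < s \<Longrightarrow> gauss_density s (u :: real^'d::finite) \<le> (2 * pi * s) powr (- real CARD('d) / 2)"
  by (simp add: gauss_density_def mult_left_le)

text \<open>The density is a radial profile composed with the norm, which is 1-Lipschitz, so
  bounding one scalar derivative is enough.\<close>

lemma gauss_density_lipschitz:
  assumes s: "0 < s"
  shows "\<exists>G. G-lipschitz_on UNIV (gauss_density s :: real^'d::finite \<Rightarrow> real)"
proof -
  define h where "h r = exp (- r\<^sup>2 / (2 * s))" for r :: real
  \<comment> \<open>The summand \<open>1 / s\<close> serves |r| \<le> 1; the summand 2 serves |r| >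
    1, where |r| / s \<le> 2 (r^2 / (2 s)), and the exponential dominates this.\<close>
  define k where "k = 2 + 1 / s"
  have k: "0 \<le> k" using s by (simp add: k_def)
  have h': "(h has_real_derivative - (r / s) * h r) (at r)" for r
    unfolding h_def using s by (auto intro!: derivative_eq_intros simp: field_simps)
  have bound: "norm (- (r / s) * h r) \<le> k" for r
  proof -
    have "\<bar>r\<bar> / s \<le> k * (1 + r\<^sup>2 / (2 * s))"
    proof (cases "\<bar>r\<bar> \<le> 1")
      case True
      then have "\<bar>r\<bar> / s \<le> 1 / s" using s by (simp add: divide_right_mono)
      also have "\<dots> \<le> k * 1" using s by (simp add: k_def)
      also have "\<dots> \<le> k * (1 + r\<^sup>2 / (2 * s))" using s k by (intro mult_left_mono) auto
      finally show ?thesis .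
    next
      case False
      then have "\<bar>r\<bar> * 1 \<le> \<bar>r\<bar> * \<bar>r\<bar>" by (intro mult_left_mono) auto
      then have "\<bar>r\<bar> \<le> r\<^sup>2" by (simp add: power2_eq_square)
      then have "\<bar>r\<bar> / s \<le> 2 * (r\<^sup>2 / (2 * s))" using s by (simp add: divide_right_mono)
      also have "\<dots> \<le> k * (1 + r\<^sup>2 / (2 * s))" using s by (intro mult_mono) (auto simp: k_def)
      finally show ?thesis .
    qed
    also have "\<dots> \<le> k * exp (r\<^sup>2 / (2 * s))"
      using k by (intro mult_left_mono exp_ge_add_one_self)
    finally have "\<bar>r\<bar> / s * h r \<le> k * exp (r\<^sup>2 / (2 * s)) * h r"
      by (rule mult_right_mono) (simp add: h_def)
    also have "\<dots> = k" by (simp add: h_def exp_minus)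
    finally show ?thesis using s by (simp add: abs_mult h_def)
  qed
  have hl: "\<bar>h x - h y\<bar> \<le> k * \<bar>x - y\<bar>" for x y
    using field_differentiable_bound[of UNIV h "\<lambda>r. - (r / s) * h r" k x y] h' bound by auto
  define c where "c = (2 * pi * s) powr (- real CARD('d) / 2)"
  have c: "0 \<le> c" by (simp add: c_def)
  have "(c * k)-lipschitz_on UNIV (gauss_density s :: real^'d \<Rightarrow> real)"
  proof (rule lipschitz_onI)
    fix u w :: "real^'d"
    have "dist (gauss_density s u) (gauss_density s w) = c * \<bar>h (norm u) - h (norm w)\<bar>"
      by (simp add: gauss_density_def c_def h_def dist_real_def right_diff_distrib[symmetric] abs_mult)
    also have "\<dots> \<le> c * (k * \<bar>norm u - norm w\<bar>)" by (intro mult_left_mono hl c)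
    also have "\<dots> \<le> c * (k * norm (u - w))"
      using c k by (intro mult_left_mono norm_triangle_ineq3) auto
    finally show "dist (gauss_density s u) (gauss_density s w) \<le> c * k * dist u w"
      by (simp add: dist_norm)
  qed (use c k in auto)
  then show ?thesis ..
qed

text \<open>Completing the square: up to a factor independent of \<open>x\<close>, the left-hand side is a Gaussian
  density in \<open>x\<close>.\<close>
lemma gauss_density_product:
  fixes w :: "real^'d::finite" and \<alpha> \<beta> s :: real
  assumes \<alpha>: "0 < \<alpha>" and \<beta>: "0 < \<beta>"
  defines "q \<equiv> s\<^sup>2 * \<beta> + \<alpha>"
  shows "\<exists>k\<ge>0. \<forall>x. gauss_density \<alpha> (w - s *\<^sub>R x) * gauss_density \<beta> x
    = k * gauss_density (\<alpha> * \<beta> / q) (x - (s * \<beta> / q) *\<^sub>R w)"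
proof -
  have q: "0 < q" using \<alpha> \<beta> by (simp add: q_def add_nonneg_pos)
  define c where "c t = (2 * pi * t) powr (- real CARD('d) / 2)" for t
  have c: "0 < c t" if "0 < t" for t using that by (simp add: c_def)
  define \<tau> where "\<tau> = \<alpha> * \<beta> / q"
  have \<tau>: "0 < \<tau>" using \<alpha> \<beta> q by (simp add: \<tau>_def)
  \<comment> \<open>In Bayesian terms \<open>x\<close> has variance \<open>\<beta>\<close> and is
    observed as \<open>w = s x + noise\<close> with noise variance \<open>\<alpha>\<close>. Then
    \<open>q\<close> is the variance of \<open>w\<close>, \<open>\<tau>\<close> the posterior
    variance and \<open>k\<close> the density of the observation at \<open>w\<close>.\<close>
  define k where "k = c \<alpha> * c \<beta> / c \<tau> * exp (- (norm w)\<^sup>2 / (2 * q))"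
  have "gauss_density \<alpha> (w - s *\<^sub>R x) * gauss_density \<beta> x
      = k * gauss_density \<tau> (x - (s * \<beta> / q) *\<^sub>R w)" for x
  proof -
    define X W Z where "X = x \<bullet> x" and "W = w \<bullet> w" and "Z = x \<bullet> w"
    have n: "(norm (u - a *\<^sub>R v))\<^sup>2 = u \<bullet> u - 2 * a * (u \<bullet> v) + a\<^sup>2 * (v \<bullet> v)"
      for u v :: "real^'d" and a
      by (subst power2_norm_eq_inner)
        (simp add: inner_diff_left inner_diff_right inner_commute[of v u] power2_eq_square algebra_simps)
    have n1: "(norm (w - s *\<^sub>R x))\<^sup>2 = W - 2 * s * Z + s\<^sup>2 * X"
      unfolding n X_def W_def Z_def by (simp add: inner_commute)
    have n2: "(norm (x - (s * \<beta> / q) *\<^sub>R w))\<^sup>2 = X - 2 * (s * \<beta> / q) * Z + (s * \<beta> / q)\<^sup>2 * W"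
      unfolding n X_def W_def Z_def ..
    have "(W - 2 * s * Z + s\<^sup>2 * X) / (2 * \<alpha>) + X / (2 * \<beta>)
        = W / (2 * q) + (X - 2 * (s * \<beta> / q) * Z + (s * \<beta> / q)\<^sup>2 * W) / (2 * \<tau>)"
    proof -
      have X: "s\<^sup>2 / (2 * \<alpha>) + 1 / (2 * \<beta>) = 1 / (2 * \<tau>)"
        using \<alpha> \<beta> q by (simp add: \<tau>_def q_def field_simps)
      have Z: "s / \<alpha> = (s * \<beta> / q) / \<tau>" using \<alpha> \<beta> q by (simp add: \<tau>_def)
      have W: "1 / (2 * \<alpha>) = 1 / (2 * q) + (s * \<beta> / q)\<^sup>2 / (2 * \<tau>)"
      proof -
        have "(s * \<beta> / q)\<^sup>2 / (2 * \<tau>) = s\<^sup>2 * \<beta> / (2 * \<alpha> * q)"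
          using \<alpha> \<beta> q by (simp add: \<tau>_def power2_eq_square mult_ac)
        moreover have "1 / (2 * q) + s\<^sup>2 * \<beta> / (2 * \<alpha> * q) = (\<alpha> + s\<^sup>2 * \<beta>) / (2 * \<alpha> * q)"
          using \<alpha> q by (simp add: field_simps)
        ultimately show ?thesis using \<alpha> q by (simp add: q_def add.commute)
      qed
      have "(W - 2 * s * Z + s\<^sup>2 * X) / (2 * \<alpha>) + X / (2 * \<beta>)
          = W * (1 / (2 * \<alpha>)) - (s / \<alpha>) * Z + X * (s\<^sup>2 / (2 * \<alpha>) + 1 / (2 * \<beta>))"
        using \<alpha> \<beta> by (simp add: diff_divide_distrib add_divide_distrib algebra_simps)
      also have "\<dots> = W * (1 / (2 * q) + (s * \<beta> / q)\<^sup>2 / (2 * \<tau>)) - ((s * \<beta> / q) / \<tau>) * Z + X * (1 / (2 * \<tau>))"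
        unfolding X Z W ..
      also have "\<dots> = W / (2 * q) + (X - 2 * (s * \<beta> / q) * Z + (s * \<beta> / q)\<^sup>2 * W) / (2 * \<tau>)"
        using \<tau> by (simp add: diff_divide_distrib add_divide_distrib algebra_simps)
      finally show ?thesis .
    qed
    then have e: "- (norm (w - s *\<^sub>R x))\<^sup>2 / (2 * \<alpha>) + - (norm x)\<^sup>2 / (2 * \<beta>)
        = - (norm w)\<^sup>2 / (2 * q) + - (norm (x - (s * \<beta> / q) *\<^sub>R w))\<^sup>2 / (2 * \<tau>)"
      unfolding n1 n2 power2_norm_eq_inner[of w] power2_norm_eq_inner[of x]
        X_def[symmetric] W_def[symmetric] minus_divide_left[symmetric] by linarith
    have g: "gauss_density t y = c t * exp (- (norm y)\<^sup>2 / (2 * t))" for t and y :: "real^'d"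
      by (simp only: gauss_density_def c_def)
    have "gauss_density \<alpha> (w - s *\<^sub>R x) * gauss_density \<beta> x
        = c \<alpha> * c \<beta> * exp (- (norm (w - s *\<^sub>R x))\<^sup>2 / (2 * \<alpha>) + - (norm x)\<^sup>2 / (2 * \<beta>))"
      by (simp only: gauss_density_def c_def exp_add mult_ac)
    also have "\<dots> = k * gauss_density \<tau> (x - (s * \<beta> / q) *\<^sub>R w)"
      unfolding e exp_add using c[OF \<tau>] by (simp add: g k_def)
    finally show ?thesis .
  qed
  moreover have "0 \<le> k" by (simp add: k_def c_def)
  ultimately show ?thesis unfolding \<tau>_def by blast
qed

text \<open>The quotient of the two integrals is the posterior mean of |x| given the observation
  \<open>w\<close>. The posterior is Gaussian with variance at most \<open>\<beta>\<close> and
  centre of norm at most \<open>\<beta> / \<alpha> * norm w\<close>, uniformly in \<open>s\<close>,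
  so \<open>gauss_abs_moment_shifted\<close> gives a bound affine in \<open>norm w\<close>.\<close>

lemma gauss_posterior_mean_bound:
  fixes w :: "real^'d::finite"
  assumes \<alpha>: "0 < \<alpha>" and \<beta>: "0 < \<beta>" and s: "s \<in> {0..1}"
  shows "(\<integral>\<^sup>+x. ennreal (gauss_density \<alpha> (w - s *\<^sub>R x) * norm x) \<partial>gauss \<beta>)
    \<le> ennreal (1 + \<beta> / \<alpha> * norm w + \<beta> * real CARD('d))
      * (\<integral>\<^sup>+x. ennreal (gauss_density \<alpha> (w - s *\<^sub>R x)) \<partial>gauss \<beta>)"
proof -
  define q where "q = s\<^sup>2 * \<beta> + \<alpha>"
  define \<tau> where "\<tau> = \<alpha> * \<beta> / q"
  define m where "m = (s * \<beta> / q) *\<^sub>R w"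
  have q: "\<alpha> \<le> q" "0 < q" using \<alpha> \<beta> by (simp_all add: q_def add_nonneg_pos)
  have \<tau>: "0 < \<tau>" "\<tau> \<le> \<beta>"
    using \<alpha> \<beta> q by (simp_all add: \<tau>_def field_simps)
  obtain k where k: "0 \<le> k"
    and eq: "\<And>x. gauss_density \<alpha> (w - s *\<^sub>R x) * gauss_density \<beta> x = k * gauss_density \<tau> (x - m)"
    using gauss_density_product[OF \<alpha> \<beta>, of w s] unfolding q_def \<tau>_def m_def by blast
  have "norm m \<le> \<beta> / \<alpha> * norm w"
  proof -
    have "s * \<beta> / q \<le> 1 * \<beta> / \<alpha>"
      using s \<alpha> \<beta> q by (intro frac_le mult_right_mono) auto
    then have "s * \<beta> / q * norm w \<le> \<beta> / \<alpha> * norm w" by (intro mult_right_mono) auto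
    then show ?thesis using s \<beta> q by (simp add: m_def)
  qed
  then have bound: "1 + norm m + \<tau> * real CARD('d) \<le> 1 + \<beta> / \<alpha> * norm w + \<beta> * real CARD('d)"
    using \<tau> by (intro add_mono mult_right_mono) auto
  have "(\<integral>\<^sup>+x. ennreal (gauss_density \<alpha> (w - s *\<^sub>R x) * norm x) \<partial>gauss \<beta>)
      = (\<integral>\<^sup>+x. ennreal k * ennreal (gauss_density \<tau> (x - m) * norm x) \<partial>lborel)"
  proof (subst nn_integral_gauss)
    have e: "gauss_density \<beta> x * (gauss_density \<alpha> (w - s *\<^sub>R x) * norm x) = k * (gauss_density \<tau> (x - m) * norm x)" for x
      using arg_cong[OF eq[of x], of "\<lambda>z. z * norm x"] by (simp only: mult_ac)
    have "ennreal (gauss_density \<beta> x) * ennreal (gauss_density \<alpha> (w - s *\<^sub>R x) * norm x)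
        = ennreal k * ennreal (gauss_density \<tau> (x - m) * norm x)" for x
      using k by (simp only: e ennreal_mult'[symmetric] gauss_density_nonneg)
    then show "(\<integral>\<^sup>+x. ennreal (gauss_density \<beta> x) * ennreal (gauss_density \<alpha> (w - s *\<^sub>R x) * norm x) \<partial>lborel)
        = (\<integral>\<^sup>+x. ennreal k * ennreal (gauss_density \<tau> (x - m) * norm x) \<partial>lborel)"
      by simp
  qed measurable
  also have "\<dots> = ennreal k * (\<integral>\<^sup>+x. ennreal (gauss_density \<tau> (x - m) * norm x) \<partial>lborel)"
    by (intro nn_integral_cmult) measurable
  also have "\<dots> \<le> ennreal k * ennreal (1 + \<beta> / \<alpha> * norm w + \<beta> * real CARD('d))"
    by (intro mult_left_mono order_trans[OF gauss_abs_moment_shifted[OF \<tau>(1)]] ennreal_leI bound) simp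
  also have "ennreal k = (\<integral>\<^sup>+x. ennreal k * ennreal (gauss_density \<tau> (x - m)) \<partial>lborel)"
    using \<tau> by (subst nn_integral_cmult)
      (auto simp: nn_integral_lborel_shift[of "\<lambda>x. ennreal (gauss_density \<tau> x)"] nn_integral_gauss_density)
  also have "\<dots> = (\<integral>\<^sup>+x. ennreal (gauss_density \<alpha> (w - s *\<^sub>R x)) \<partial>gauss \<beta>)"
    using eq k by (subst nn_integral_gauss) (auto simp: mult.commute simp flip: ennreal_mult')
  finally show ?thesis by (simp add: mult.commute)
qed

section \<open>Regularity of the regularised velocity field\<close>

lemma borel_measurable_radial_proj [measurable]:
  "radial_proj S \<in> borel_measurable (borel :: 'a::euclidean_space measure)"
  unfolding radial_proj_def by measurable

lemma norm_radial_proj_le: "0 < S \<Longrightarrow> norm (radial_proj S x) \<le> S"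
  by (simp add: radial_proj_def)

section \<open>Bounds for density, flux and velocity that are uniform in the stationary
  measure\<close>

context
  fixes \<alpha> S kappa :: real and m :: "(real^'d::finite) measure"
  assumes \<alpha>: "0 < \<alpha>" "\<alpha> < 1" and S: "0 < S"
    and kappa_def: "kappa = 1 + 2 * S\<^sup>2 + 2 * real CARD('d)"
    and pm: "prob_space m" and sm: "sets m = sets borel"
begin

interpretation m: prob_space m by (rule pm)
interpretation g: prob_space "gauss (1 - \<alpha>) :: (real^'d) measure" using \<alpha> by (intro prob_space_gauss) simp
interpretation gm: pair_prob_space "gauss (1 - \<alpha>) :: (real^'d) measure" m ..

declare sm [measurable_cong, simp]

text \<open>The truncation is moved from the measure into the integrand, so that all integrals run
  over a product with \<open>m\<close> itself.\<close>

definition interp :: "real \<Rightarrow> (real^'d) \<times> (real^'d) \<Rightarrow> real^'d" where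
  "interp t w = (1 - t) *\<^sub>R fst w + t *\<^sub>R radial_proj S (snd w)"

text \<open>The time derivative of \<open>interp\<close>; its moments therefore control the
  dependence on time.\<close>

definition disp :: "(real^'d) \<times> (real^'d) \<Rightarrow> real^'d" where
  "disp w = radial_proj S (snd w) - fst w"

private abbreviation "Q \<equiv> (gauss (1 - \<alpha>) :: (real^'d) measure) \<Otimes>\<^sub>M m"

lemma measurable_interp_disp [measurable]:
  "interp t \<in> borel_measurable Q" "disp \<in> borel_measurable Q"
  unfolding interp_def[abs_def] disp_def[abs_def] by measurable

lemma pair_truncate: "(gauss (1 - \<alpha>) :: (real^'d) measure) \<Otimes>\<^sub>M truncate S m
    = distr Q (borel \<Otimes>\<^sub>M borel) (\<lambda>(x, y). (x, radial_proj S y))"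
proof -
  have *: "distr (gauss (1 - \<alpha>)) borel (\<lambda>x. x) = (gauss (1 - \<alpha>) :: (real^'d) measure)"
    by (intro distr_id2) simp
  have "prob_space (distr m borel (radial_proj S))" by (intro m.prob_space_distr) measurable
  then have "distr (gauss (1 - \<alpha>) :: (real^'d) measure) borel (\<lambda>x. x) \<Otimes>\<^sub>M distr m borel (radial_proj S)
    = distr Q (borel \<Otimes>\<^sub>M borel) (\<lambda>(x, y). (x, radial_proj S y))"
    by (intro pair_measure_distr) (auto intro: prob_space_imp_sigma_finite)
  then show ?thesis unfolding * truncate_def .
qed

lemma rho_eq: "rho \<alpha> S m t z = (\<integral>w. gauss_density \<alpha> (z - interp t w) \<partial>Q)"
  unfolding rho_def pair_truncate
  by (subst integral_distr) (auto simp: interp_def case_prod_unfold)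

lemma flux_eq: "flux \<alpha> S m t z = (\<integral>w. gauss_density \<alpha> (z - interp t w) *\<^sub>R disp w \<partial>Q)"
  unfolding flux_def pair_truncate
  by (subst integral_distr) (auto simp: interp_def disp_def case_prod_unfold)

lemma square_integrals:
  shows "integrable Q (\<lambda>w. (norm (fst w))\<^sup>2)" "(\<integral>w. (norm (fst w))\<^sup>2 \<partial>Q) = (1 - \<alpha>) * real CARD('d)"
proof -
  have "(\<integral>\<^sup>+w. ennreal ((norm (fst w))\<^sup>2) \<partial>Q) = (\<integral>\<^sup>+x. ennreal ((norm x)\<^sup>2) \<partial>(gauss (1 - \<alpha>) :: (real^'d) measure))"
    by (subst m.nn_integral_fst[symmetric]) (auto simp: m.emeasure_space_1)
  also have "\<dots> = ennreal ((1 - \<alpha>) * real CARD('d))"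
    using \<alpha> by (subst nn_integral_gauss) (simp_all add: ennreal_mult'[symmetric] gauss_second_moment)
  finally have "has_bochner_integral Q (\<lambda>w. (norm (fst w))\<^sup>2) ((1 - \<alpha>) * real CARD('d))"
    using \<alpha> by (intro has_bochner_integral_nn_integral) auto
  then show "integrable Q (\<lambda>w. (norm (fst w))\<^sup>2)" "(\<integral>w. (norm (fst w))\<^sup>2 \<partial>Q) = (1 - \<alpha>) * real CARD('d)"
    by (simp_all add: has_bochner_integral_iff)
qed

lemma affine_square_integral:
  shows "integrable Q (\<lambda>w. a + b * (norm (fst w))\<^sup>2)"
    "(\<integral>w. a + b * (norm (fst w))\<^sup>2 \<partial>Q) = a + b * ((1 - \<alpha>) * real CARD('d))"
proof -
  have 1: "integrable Q (\<lambda>w. b * (norm (fst w))\<^sup>2)" using square_integrals(1) by simp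
  show "integrable Q (\<lambda>w. a + b * (norm (fst w))\<^sup>2)"
    by (intro Bochner_Integration.integrable_add 1) simp
  show "(\<integral>w. a + b * (norm (fst w))\<^sup>2 \<partial>Q) = a + b * ((1 - \<alpha>) * real CARD('d))"
    by (subst Bochner_Integration.integral_add[OF _ 1]) (simp_all add: square_integrals gm.prob_space)
qed

lemma norm_disp_le: "norm (disp w) \<le> S + norm (fst w)"
  using norm_triangle_ineq4[of "radial_proj S (snd w)" "fst w"] norm_radial_proj_le[OF S, of "snd w"]
  by (simp add: disp_def)

text \<open>\<open>kappa\<close> stems from |disp|^2 \<le> 2 S^2 + 2 |x|^2 and the Gaussian second
  moment; its summand 1 lets it bound the first moment too, by n \<le> 1 + n^2.\<close>

lemma disp_integrals:
  shows "integrable Q (\<lambda>w. norm (disp w))" "(\<integral>w. norm (disp w) \<partial>Q) \<le> kappa"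
    "integrable Q (\<lambda>w. (norm (disp w))\<^sup>2)" "(\<integral>w. (norm (disp w))\<^sup>2 \<partial>Q) \<le> kappa"
proof -
  let ?f = "\<lambda>w :: (real^'d) \<times> (real^'d). 1 + 2 * S\<^sup>2 + 2 * (norm (fst w))\<^sup>2"
  have f: "integrable Q ?f" by (rule affine_square_integral)
  have "(\<integral>w. ?f w \<partial>Q) = 1 + 2 * S\<^sup>2 + 2 * ((1 - \<alpha>) * real CARD('d))"
    by (rule affine_square_integral)
  also have "\<dots> \<le> kappa" using \<alpha> by (simp add: kappa_def mult_left_le_one_le)
  finally have fk: "(\<integral>w. ?f w \<partial>Q) \<le> kappa" .
  have sq: "(norm (disp w))\<^sup>2 \<le> 2 * S\<^sup>2 + 2 * (norm (fst w))\<^sup>2" for w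
  proof -
    have "(norm (disp w))\<^sup>2 \<le> (S + norm (fst w))\<^sup>2" by (intro power_mono norm_disp_le) simp
    also have "\<dots> \<le> 2 * S\<^sup>2 + 2 * (norm (fst w))\<^sup>2"
      using zero_le_power2[of "S - norm (fst w)"] by (simp add: power2_eq_square algebra_simps)
    finally show ?thesis .
  qed
  have le2: "(norm (disp w))\<^sup>2 \<le> ?f w" for w using sq[of w] by linarith
  have le1: "norm (disp w) \<le> ?f w" for w
  proof -
    have "norm (disp w) \<le> 1 + (norm (disp w))\<^sup>2"
      using zero_le_power2[of "norm (disp w) - 1 / 2"] by (simp add: power2_eq_square algebra_simps)
    then show ?thesis using sq[of w] by linarith
  qed
  show 1: "integrable Q (\<lambda>w. norm (disp w))"
    by (rule Bochner_Integration.integrable_bound[OF f]) (use le1 in \<open>auto intro: order_trans[OF _ abs_ge_self]\<close>)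
  show 2: "integrable Q (\<lambda>w. (norm (disp w))\<^sup>2)"
    by (rule Bochner_Integration.integrable_bound[OF f]) (use le2 in \<open>auto intro: order_trans[OF _ abs_ge_self]\<close>)
  show "(\<integral>w. norm (disp w) \<partial>Q) \<le> kappa"
    using integral_mono[OF 1 f le1] fk by linarith
  show "(\<integral>w. (norm (disp w))\<^sup>2 \<partial>Q) \<le> kappa"
    using integral_mono[OF 2 f le2] fk by linarith
qed

lemma kernel_integrable: "integrable Q (\<lambda>w. gauss_density \<alpha> (z - interp t w))"
  by (rule gm.integrable_const_bound[where B = "(2 * pi * \<alpha>) powr (- real CARD('d) / 2)"])
    (use \<alpha> gauss_density_le in auto)

lemma flux_integrable: "integrable Q (\<lambda>w. gauss_density \<alpha> (z - interp t w) *\<^sub>R disp w)"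
proof (rule Bochner_Integration.integrable_bound)
  let ?B = "(2 * pi * \<alpha>) powr (- real CARD('d) / 2)"
  show "integrable Q (\<lambda>w. ?B * norm (disp w))" using disp_integrals(1) by simp
  show "AE w in Q. norm (gauss_density \<alpha> (z - interp t w) *\<^sub>R disp w) \<le> norm (?B * norm (disp w))"
  proof (intro AE_I2)
    fix w
    have "gauss_density \<alpha> (z - interp t w) * norm (disp w) \<le> ?B * norm (disp w)"
      using \<alpha> by (intro mult_right_mono gauss_density_le) auto
    then show "norm (gauss_density \<alpha> (z - interp t w) *\<^sub>R disp w) \<le> norm (?B * norm (disp w))"
      by simp
  qed
qed measurable

text \<open>Jensen's inequality moves the expectation into the exponent, where the Gaussian second
  moment and the bound \<open>S\<close> suffice. Nothing specific to \<open>m\<close> remains, so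
  one Lipschitz constant will serve all coefficients.\<close>

lemma rho_lower_bound:
  assumes r: "norm z \<le> r" and t: "t \<in> {0..1}"
  shows "(2 * pi * \<alpha>) powr (- real CARD('d) / 2)
      * exp (- (3 * (r\<^sup>2 + real CARD('d) + S\<^sup>2)) / (2 * \<alpha>)) \<le> rho \<alpha> S m t z"
proof -
  define c where "c = (2 * pi * \<alpha>) powr (- real CARD('d) / 2)"
  \<comment> \<open>An upper bound for the mean of \<open>h\<close>, with
    \<open>1 - \<alpha>\<close> replaced by 1; the factor 3 comes from (r + a + S)^2 \<le> 3 (r^2 +
    a^2 + S^2).\<close>
  define s0 where "s0 = 3 * (r\<^sup>2 + real CARD('d) + S\<^sup>2) / (2 * \<alpha>)"
  define h where "h w = 3 * (r\<^sup>2 + (norm (fst w))\<^sup>2 + S\<^sup>2) / (2 * \<alpha>)" for w :: "(real^'d) \<times> (real^'d)"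
  have c: "0 \<le> c" by (simp add: c_def)
  have h: "h = (\<lambda>w. 3 * (r\<^sup>2 + S\<^sup>2) / (2 * \<alpha>) + 3 / (2 * \<alpha>) * (norm (fst w))\<^sup>2)"
    by (simp add: h_def fun_eq_iff add_divide_distrib distrib_left)
  have hint: "integrable Q h" unfolding h by (rule affine_square_integral)
  have "(\<integral>w. h w \<partial>Q) = 3 * (r\<^sup>2 + (1 - \<alpha>) * real CARD('d) + S\<^sup>2) / (2 * \<alpha>)"
    unfolding h affine_square_integral(2) by (simp add: add_divide_distrib distrib_left)
  also have "\<dots> \<le> s0"
    unfolding s0_def using \<alpha> by (intro divide_right_mono mult_left_mono add_mono) (auto simp: mult_left_le_one_le)
  finally have hs: "(\<integral>w. h w \<partial>Q) \<le> s0" .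
  txt \<open>The tangent of \<open>exp\<close> at \<open>- s0\<close> gives Jensen's inequality.\<close>
  have le: "c * exp (- s0) * (1 + s0 - h w) \<le> gauss_density \<alpha> (z - interp t w)" for w
  proof -
    define a b where "a = norm (fst w)" and "b = norm (radial_proj S (snd w))"
    have "norm (z - interp t w) \<le> norm z + norm (interp t w)" by (rule norm_triangle_ineq4)
    also have "norm (interp t w) \<le> (1 - t) * a + t * b"
      unfolding interp_def a_def b_def using t by (intro order_trans[OF norm_triangle_ineq]) simp
    also have "\<dots> \<le> 1 * a + 1 * S"
      using t norm_radial_proj_le[OF S, of "snd w"] by (intro add_mono mult_mono) (auto simp: a_def b_def)
    finally have "norm (z - interp t w) \<le> r + a + S" using r by simp
    then have "(norm (z - interp t w))\<^sup>2 \<le> (r + a + S)\<^sup>2" by (intro power_mono) auto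
    also have "\<dots> \<le> 3 * (r\<^sup>2 + a\<^sup>2 + S\<^sup>2)"
      using zero_le_power2[of "r - a"] zero_le_power2[of "r - S"] zero_le_power2[of "a - S"]
      by (simp add: power2_eq_square algebra_simps)
    finally have "(norm (z - interp t w))\<^sup>2 / (2 * \<alpha>) \<le> h w"
      unfolding h_def a_def using \<alpha> by (intro divide_right_mono) auto
    then have "exp (- h w) \<le> exp (- (norm (z - interp t w))\<^sup>2 / (2 * \<alpha>))" by simp
    moreover have "exp (- s0) * (1 + s0 - h w) \<le> exp (- s0) * exp (s0 - h w)"
      using exp_ge_add_one_self[of "s0 - h w"] by (intro mult_left_mono) (auto simp: algebra_simps)
    moreover have "exp (- s0) * exp (s0 - h w) = exp (- h w)" by (simp add: exp_add[symmetric])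
    ultimately have "exp (- s0) * (1 + s0 - h w) \<le> exp (- (norm (z - interp t w))\<^sup>2 / (2 * \<alpha>))" by linarith
    then have "c * (exp (- s0) * (1 + s0 - h w)) \<le> c * exp (- (norm (z - interp t w))\<^sup>2 / (2 * \<alpha>))"
      using c by (rule mult_left_mono)
    then show ?thesis by (simp only: gauss_density_def c_def mult.assoc)
  qed
  have "c * exp (- s0) * 1 \<le> c * exp (- s0) * (1 + s0 - (\<integral>w. h w \<partial>Q))"
    using hs c by (intro mult_left_mono) auto
  also have "\<dots> = (\<integral>w. c * exp (- s0) * (1 + s0 - h w) \<partial>Q)" using hint by (simp add: gm.prob_space)
  also have "\<dots> \<le> rho \<alpha> S m t z"
    unfolding rho_eq by (rule integral_mono) (use hint kernel_integrable le in auto)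
  finally show ?thesis by (simp only: c_def s0_def minus_divide_left mult_1_right)
qed

lemma rho_pos: "t \<in> {0..1} \<Longrightarrow> 0 < rho \<alpha> S m t z"
  using \<alpha> by (intro less_le_trans[OF _ rho_lower_bound[OF order_refl]]) auto

lemma kernel_diff_le:
  assumes G: "G-lipschitz_on UNIV (gauss_density \<alpha> :: real^'d \<Rightarrow> real)"
  shows "\<bar>gauss_density \<alpha> (z - interp t w) - gauss_density \<alpha> (z' - interp t' w)\<bar>
    \<le> G * (norm (z - z') + \<bar>t - t'\<bar> * norm (disp w))"
proof -
  have "interp t w - interp t' w = (t - t') *\<^sub>R disp w"
    by (simp add: interp_def disp_def algebra_simps)
  then have eq: "(z - interp t w) - (z' - interp t' w) = (z - z') - (t - t') *\<^sub>R disp w"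
    by (simp add: algebra_simps)
  have n: "norm ((z - interp t w) - (z' - interp t' w)) \<le> norm (z - z') + \<bar>t - t'\<bar> * norm (disp w)"
    unfolding eq by (rule order_trans[OF norm_triangle_ineq4]) simp
  have "\<bar>gauss_density \<alpha> (z - interp t w) - gauss_density \<alpha> (z' - interp t' w)\<bar>
      \<le> G * norm ((z - interp t w) - (z' - interp t' w))"
    using lipschitz_onD[OF G] by (simp add: dist_norm)
  also have "\<dots> \<le> G * (norm (z - z') + \<bar>t - t'\<bar> * norm (disp w))"
    by (intro mult_left_mono n lipschitz_on_nonneg[OF G])
  finally show ?thesis .
qed

text \<open>A change of time shifts the kernel argument by a multiple of \<open>disp\<close>. The
  flux carries one more factor \<open>disp\<close>, hence the need for its second moment.\<close>

lemma rho_flux_lipschitz: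
  assumes G: "G-lipschitz_on UNIV (gauss_density \<alpha> :: real^'d \<Rightarrow> real)"
  shows "\<bar>rho \<alpha> S m t z - rho \<alpha> S m t' z'\<bar> \<le> G * kappa * (norm (z - z') + \<bar>t - t'\<bar>)"
    and "norm (flux \<alpha> S m t z - flux \<alpha> S m t' z') \<le> G * kappa * (norm (z - z') + \<bar>t - t'\<bar>)"
proof -
  have G0: "0 \<le> G" by (rule lipschitz_on_nonneg[OF G])
  have k1: "1 \<le> kappa" by (simp add: kappa_def)
  have i1: "integrable Q (\<lambda>w. G * (norm (z - z') + \<bar>t - t'\<bar> * norm (disp w)))"
    using disp_integrals(1) by simp
  have "\<bar>rho \<alpha> S m t z - rho \<alpha> S m t' z'\<bar>
      = \<bar>\<integral>w. gauss_density \<alpha> (z - interp t w) - gauss_density \<alpha> (z' - interp t' w) \<partial>Q\<bar>"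
    unfolding rho_eq using kernel_integrable by simp
  also have "\<dots> \<le> (\<integral>w. \<bar>gauss_density \<alpha> (z - interp t w) - gauss_density \<alpha> (z' - interp t' w)\<bar> \<partial>Q)"
    by (rule integral_abs_bound)
  also have "\<dots> \<le> (\<integral>w. G * (norm (z - z') + \<bar>t - t'\<bar> * norm (disp w)) \<partial>Q)"
    by (intro integral_mono i1 kernel_diff_le G integrable_abs Bochner_Integration.integrable_diff kernel_integrable)
  also have "\<dots> = G * (norm (z - z') + \<bar>t - t'\<bar> * (\<integral>w. norm (disp w) \<partial>Q))"
    using disp_integrals(1) by (simp add: gm.prob_space)
  also have "\<dots> \<le> G * (norm (z - z') * kappa + \<bar>t - t'\<bar> * kappa)"
    using G0 k1 disp_integrals(2) by (intro mult_left_mono add_mono) (auto simp: mult_le_cancel_left1)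
  finally show "\<bar>rho \<alpha> S m t z - rho \<alpha> S m t' z'\<bar> \<le> G * kappa * (norm (z - z') + \<bar>t - t'\<bar>)"
    by (simp add: algebra_simps)
  have i2: "integrable Q (\<lambda>w. G * (norm (z - z') * norm (disp w) + \<bar>t - t'\<bar> * (norm (disp w))\<^sup>2))"
    using disp_integrals by simp
  have "norm (flux \<alpha> S m t z - flux \<alpha> S m t' z')
      = norm (\<integral>w. (gauss_density \<alpha> (z - interp t w) - gauss_density \<alpha> (z' - interp t' w)) *\<^sub>R disp w \<partial>Q)"
    unfolding flux_eq using flux_integrable by (simp add: scaleR_diff_left)
  also have "\<dots> \<le> (\<integral>w. norm ((gauss_density \<alpha> (z - interp t w) - gauss_density \<alpha> (z' - interp t' w)) *\<^sub>R disp w) \<partial>Q)"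
    by (rule integral_norm_bound)
  also have "\<dots> \<le> (\<integral>w. G * (norm (z - z') * norm (disp w) + \<bar>t - t'\<bar> * (norm (disp w))\<^sup>2) \<partial>Q)"
  proof (intro integral_mono i2 integrable_norm)
    show "integrable Q (\<lambda>w. (gauss_density \<alpha> (z - interp t w) - gauss_density \<alpha> (z' - interp t' w)) *\<^sub>R disp w)"
      using flux_integrable by (simp add: scaleR_diff_left)
    fix w
    show "norm ((gauss_density \<alpha> (z - interp t w) - gauss_density \<alpha> (z' - interp t' w)) *\<^sub>R disp w)
        \<le> G * (norm (z - z') * norm (disp w) + \<bar>t - t'\<bar> * (norm (disp w))\<^sup>2)"
      using mult_right_mono[OF kernel_diff_le[OF G, of z t w z' t'] norm_ge_zero[of "disp w"]]
      unfolding norm_scaleR real_norm_def by (simp only: distrib_left distrib_right power2_eq_square mult.assoc)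
  qed
  also have "\<dots> = G * (norm (z - z') * (\<integral>w. norm (disp w) \<partial>Q) + \<bar>t - t'\<bar> * (\<integral>w. (norm (disp w))\<^sup>2 \<partial>Q))"
    using disp_integrals by simp
  also have "\<dots> \<le> G * (norm (z - z') * kappa + \<bar>t - t'\<bar> * kappa)"
    using G0 disp_integrals by (intro mult_left_mono add_mono) auto
  finally show "norm (flux \<alpha> S m t z - flux \<alpha> S m t' z') \<le> G * kappa * (norm (z - z') + \<bar>t - t'\<bar>)"
    by (simp add: algebra_simps)
qed

text \<open>The displacement is at most \<open>S + norm (fst w)\<close>, and the posterior bound
  controls the second part by a multiple of \<open>rho\<close> itself, which cancels in the
  quotient.\<close>

lemma velocity_growth:
  assumes t: "t \<in> {0..1}"
  shows "norm (velocity \<alpha> S m z t)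
    \<le> (S + 1 + (1 - \<alpha>) / \<alpha> * (1 + S) + (1 - \<alpha>) * real CARD('d)) * (1 + norm z)"
proof -
  define \<beta> where "\<beta> = 1 - \<alpha>"
  have \<beta>: "0 < \<beta>" using \<alpha> by (simp add: \<beta>_def)
  define c where "c = 1 + \<beta> / \<alpha> * (norm z + S) + \<beta> * real CARD('d)"
  have c: "0 \<le> c" unfolding c_def using \<alpha> \<beta> S by (intro add_nonneg_nonneg mult_nonneg_nonneg) auto
  have rho: "ennreal (rho \<alpha> S m t z) = (\<integral>\<^sup>+w. ennreal (gauss_density \<alpha> (z - interp t w)) \<partial>Q)"
    unfolding rho_eq using kernel_integrable by (intro nn_integral_eq_integral[symmetric]) auto
  have snd: "(\<integral>\<^sup>+w. f w \<partial>Q) = (\<integral>\<^sup>+y. \<integral>\<^sup>+x. f (x, y) \<partial>gauss \<beta> \<partial>m)"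
    if [measurable]: "f \<in> borel_measurable Q" for f
    unfolding \<beta>_def using gm.nn_integral_snd[of f] by simp
  \<comment> \<open>With the target point \<open>y\<close> fixed in the outer integral, the inner
    one is a Gaussian posterior with observation \<open>z - t *\<^sub>R radial_proj S y\<close> and
    scale \<open>1 - t\<close>.\<close>
  have "(\<integral>\<^sup>+w. ennreal (gauss_density \<alpha> (z - interp t w) * norm (fst w)) \<partial>Q)
      = (\<integral>\<^sup>+y. \<integral>\<^sup>+x. ennreal (gauss_density \<alpha> ((z - t *\<^sub>R radial_proj S y) - (1 - t) *\<^sub>R x) * norm x) \<partial>gauss \<beta> \<partial>m)"
    by (subst snd) (auto simp: interp_def algebra_simps)
  also have "\<dots> \<le> (\<integral>\<^sup>+y. ennreal c *
      (\<integral>\<^sup>+x. ennreal (gauss_density \<alpha> ((z - t *\<^sub>R radial_proj S y) - (1 - t) *\<^sub>R x)) \<partial>gauss \<beta>) \<partial>m)"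
  proof (intro nn_integral_mono order_trans[OF gauss_posterior_mean_bound] mult_right_mono ennreal_leI)
    fix y
    have "norm (z - t *\<^sub>R radial_proj S y) \<le> norm z + t * norm (radial_proj S y)"
      using norm_triangle_ineq4[of z "t *\<^sub>R radial_proj S y"] t by simp
    also have "\<dots> \<le> norm z + 1 * S"
      using t norm_radial_proj_le[OF S, of y] by (intro add_mono mult_mono) auto
    finally show "1 + \<beta> / \<alpha> * norm (z - t *\<^sub>R radial_proj S y) + \<beta> * real CARD('d) \<le> c"
      unfolding c_def using \<alpha> \<beta> by (intro add_mono mult_left_mono) auto
  qed (use \<alpha> \<beta> t in auto)
  also have "\<dots> = ennreal c * (\<integral>\<^sup>+w. ennreal (gauss_density \<alpha> (z - interp t w)) \<partial>Q)"
    by (subst snd, measurable, subst nn_integral_cmult[symmetric]) (auto simp: interp_def algebra_simps \<beta>_def)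
  finally have X: "(\<integral>\<^sup>+w. ennreal (gauss_density \<alpha> (z - interp t w) * norm (fst w)) \<partial>Q)
      \<le> ennreal c * ennreal (rho \<alpha> S m t z)" by (simp add: rho)
  have "ennreal (norm (flux \<alpha> S m t z)) \<le> (\<integral>\<^sup>+w. norm (gauss_density \<alpha> (z - interp t w) *\<^sub>R disp w) \<partial>Q)"
    unfolding flux_eq by (rule integral_norm_bound_ennreal[OF flux_integrable])
  also have "\<dots> \<le> (\<integral>\<^sup>+w. ennreal S * ennreal (gauss_density \<alpha> (z - interp t w))
      + ennreal (gauss_density \<alpha> (z - interp t w) * norm (fst w)) \<partial>Q)"
  proof (intro nn_integral_mono)
    fix w
    have "norm (gauss_density \<alpha> (z - interp t w) *\<^sub>R disp w) \<le> gauss_density \<alpha> (z - interp t w) * (S + norm (fst w))"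
      by (simp add: mult_left_mono norm_disp_le)
    then show "ennreal (norm (gauss_density \<alpha> (z - interp t w) *\<^sub>R disp w))
      \<le> ennreal S * ennreal (gauss_density \<alpha> (z - interp t w))
      + ennreal (gauss_density \<alpha> (z - interp t w) * norm (fst w))"
      using S by (simp add: ennreal_mult'[symmetric] ennreal_plus[symmetric] algebra_simps del: ennreal_plus)
  qed
  also have "\<dots> = ennreal S * ennreal (rho \<alpha> S m t z)
      + (\<integral>\<^sup>+w. ennreal (gauss_density \<alpha> (z - interp t w) * norm (fst w)) \<partial>Q)"
    by (subst nn_integral_add) (auto simp: nn_integral_cmult rho)
  also have "\<dots> \<le> ennreal S * ennreal (rho \<alpha> S m t z) + ennreal c * ennreal (rho \<alpha> S m t z)"
    by (intro add_left_mono X)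
  also have "\<dots> = ennreal ((S + c) * rho \<alpha> S m t z)"
    using S c rho_pos[OF t, of z]
    by (simp add: ennreal_mult'[symmetric] ennreal_plus[symmetric] algebra_simps del: ennreal_plus)
  finally have "norm (flux \<alpha> S m t z) \<le> (S + c) * rho \<alpha> S m t z"
    using S c rho_pos[OF t, of z] by (subst (asm) ennreal_le_iff) auto
  then have "norm (velocity \<alpha> S m z t) \<le> S + c"
    using rho_pos[OF t, of z] by (simp add: velocity_def field_simps)
  also have "\<dots> \<le> (S + 1 + \<beta> / \<alpha> * (1 + S) + \<beta> * real CARD('d)) * (1 + norm z)"
  proof -
    have "(S + 1 + \<beta> / \<alpha> * (1 + S) + \<beta> * real CARD('d)) * (1 + norm z) - (S + c)
        = (S + 1 + \<beta> * real CARD('d)) * norm z + \<beta> / \<alpha> * (1 + S * norm z)"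
      by (simp add: c_def algebra_simps add_divide_distrib)
    moreover have "0 \<le> (S + 1 + \<beta> * real CARD('d)) * norm z + \<beta> / \<alpha> * (1 + S * norm z)"
      using S \<alpha> \<beta> by (intro add_nonneg_nonneg mult_nonneg_nonneg) auto
    ultimately show ?thesis by linarith
  qed
  finally show ?thesis by (simp add: \<beta>_def)
qed

text \<open>At time 1 the starting point drops out and a Gaussian mixture over \<open>m\<close>
  remains; its kernel is the one used for the gluing.\<close>

lemma ennreal_rho_1: "ennreal (rho \<alpha> S m 1 z) = (\<integral>\<^sup>+y. ennreal (gauss_density \<alpha> (z - radial_proj S y)) \<partial>m)"
proof -
  have "ennreal (rho \<alpha> S m 1 z) = (\<integral>\<^sup>+w. ennreal (gauss_density \<alpha> (z - interp 1 w)) \<partial>Q)"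
    unfolding rho_eq using kernel_integrable by (intro nn_integral_eq_integral[symmetric]) auto
  also have "\<dots> = (\<integral>\<^sup>+y. \<integral>\<^sup>+x. ennreal (gauss_density \<alpha> (z - interp 1 (x, y))) \<partial>(gauss (1 - \<alpha>) :: (real^'d) measure) \<partial>m)"
    by (subst gm.nn_integral_snd[symmetric]) auto
  finally show ?thesis by (simp add: interp_def g.emeasure_space_1[simplified])
qed

text \<open>Quotient rule in the form \<rho> (v - v') = (J - J') + (\<rho>' - \<rho>) v', which
  calls for a lower bound of \<rho> at one point and a velocity bound at the other.\<close>

lemma velocity_lipschitz:
  assumes G: "G-lipschitz_on UNIV (gauss_density \<alpha> :: real^'d \<Rightarrow> real)"
    and t: "t \<in> {0..1}" "t' \<in> {0..1}" and c: "0 < c" "c \<le> rho \<alpha> S m t z"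
    and B: "norm (velocity \<alpha> S m z' t') \<le> B"
  shows "norm (velocity \<alpha> S m z t - velocity \<alpha> S m z' t')
    \<le> G * kappa * (1 + B) / c * (norm (z - z') + \<bar>t - t'\<bar>)"
proof -
  define \<Delta> where "\<Delta> = norm (z - z') + \<bar>t - t'\<bar>"
  define \<rho> \<rho>' where "\<rho> = rho \<alpha> S m t z" and "\<rho>' = rho \<alpha> S m t' z'"
  define v v' where "v = velocity \<alpha> S m z t" and "v' = velocity \<alpha> S m z' t'"
  have \<rho>: "0 < \<rho>" "0 < \<rho>'" using rho_pos t by (auto simp: \<rho>_def \<rho>'_def)
  have J: "flux \<alpha> S m t z = \<rho> *\<^sub>R v" "flux \<alpha> S m t' z' = \<rho>' *\<^sub>R v'"
    using \<rho> by (simp_all add: v_def v'_def velocity_def \<rho>_def \<rho>'_def)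
  have "\<rho> *\<^sub>R (v - v') = (flux \<alpha> S m t z - flux \<alpha> S m t' z') + (\<rho>' - \<rho>) *\<^sub>R v'"
    by (simp add: J algebra_simps)
  then have "\<rho> * norm (v - v') = norm ((flux \<alpha> S m t z - flux \<alpha> S m t' z') + (\<rho>' - \<rho>) *\<^sub>R v')"
    using \<rho> by (metis abs_of_pos norm_scaleR)
  also have "\<dots> \<le> norm (flux \<alpha> S m t z - flux \<alpha> S m t' z') + \<bar>\<rho> - \<rho>'\<bar> * norm v'"
    by (rule order_trans[OF norm_triangle_ineq]) (simp add: abs_minus_commute)
  also have "\<dots> \<le> G * kappa * \<Delta> + G * kappa * \<Delta> * B"
    using rho_flux_lipschitz[OF G, of t z t' z'] B norm_ge_zero[of v']
    unfolding \<Delta>_def \<rho>_def \<rho>'_def v'_def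
    by (intro add_mono mult_mono) (auto intro: order_trans[OF abs_ge_zero])
  finally have *: "\<rho> * norm (v - v') \<le> G * kappa * (1 + B) * \<Delta>" by (simp add: algebra_simps)
  have "c * norm (v - v') \<le> \<rho> * norm (v - v')" using c by (intro mult_right_mono) (auto simp: \<rho>_def)
  then have "norm (v - v') \<le> G * kappa * (1 + B) * \<Delta> / c"
    using * c by (simp add: field_simps)
  then show ?thesis by (simp add: v_def v'_def \<Delta>_def)
qed

end

section \<open>Growth and Lipschitz constants of the cut off velocity\<close>

lemma C1_lipschitz_on_cball:
  fixes f :: "real^'d::finite \<Rightarrow> real"
  assumes f: "C_k 1 f"
  shows "\<exists>B\<ge>0. \<forall>x\<in>cball 0 r. \<forall>y\<in>cball 0 r. \<bar>f x - f y\<bar> \<le> B * norm (x - y)"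
proof -
  have d: "(f has_derivative frechet_derivative f (at x)) (at x)" for x
    using f by (simp add: differentiable_on_def frechet_derivative_works[symmetric])
  have "\<exists>b. \<forall>x\<in>cball 0 r. \<bar>partial i f x\<bar> \<le> b" for i
  proof -
    have "continuous_on (cball 0 r) (partial i f)"
      using f by (auto intro: continuous_on_subset)
    then have "bounded (partial i f ` cball 0 r)"
      by (intro compact_imp_bounded compact_continuous_image) auto
    then show ?thesis by (auto simp: bounded_iff)
  qed
  then obtain b where b: "\<And>i x. x \<in> cball 0 r \<Longrightarrow> \<bar>partial i f x\<bar> \<le> b i" by metis
  define B where "B = (\<Sum>i\<in>UNIV. \<bar>b i\<bar>)"
  have on: "onorm (frechet_derivative f (at x)) \<le> B" if x: "x \<in> cball 0 r" for x
  proof (rule onorm_bound)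
    fix h :: "real^'d"
    have lin: "linear (frechet_derivative f (at x))" using d by (rule has_derivative_linear)
    have "frechet_derivative f (at x) h = frechet_derivative f (at x) (\<Sum>i\<in>UNIV. (h $ i) *\<^sub>R axis i 1)"
      using basis_expansion[of h] by (simp add: scalar_mult_eq_scaleR)
    also have "\<dots> = (\<Sum>i\<in>UNIV. h $ i * partial i f x)"
      by (simp add: linear_sum[OF lin] linear_scale[OF lin] partial_def)
    finally have "norm (frechet_derivative f (at x) h) \<le> (\<Sum>i\<in>UNIV. \<bar>h $ i * partial i f x\<bar>)"
      by (simp add: sum_abs)
    also have "\<dots> \<le> (\<Sum>i\<in>UNIV. norm h * \<bar>b i\<bar>)"
      unfolding abs_mult
      by (intro sum_mono mult_mono component_le_norm_cart order_trans[OF b[OF x] abs_ge_self]) auto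
    also have "\<dots> = B * norm h" by (simp add: B_def sum_distrib_left mult.commute)
    finally show "norm (frechet_derivative f (at x) h) \<le> B * norm h" .
  qed (simp add: B_def sum_nonneg)
  have "norm (f x - f y) \<le> B * norm (x - y)" if "x \<in> cball 0 r" "y \<in> cball 0 r" for x y
    using that d on by (intro differentiable_bound[of "cball 0 r" f "\<lambda>x. frechet_derivative f (at x)"])
      (auto intro: has_derivative_at_withinI)
  then show ?thesis by (intro exI[of _ B]) (auto simp: B_def sum_nonneg)
qed

text \<open>The constant of \<open>velocity_growth\<close>, free of \<open>R\<close> and of the
  measure; the type argument carries the dimension.\<close>

definition growth_const :: "real \<Rightarrow> real \<Rightarrow> 'd::finite itself \<Rightarrow> real" where
  "growth_const \<alpha> S _ = S + 1 + (1 - \<alpha>) / \<alpha> * (1 + S) + (1 - \<alpha>) * real CARD('d)"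

lemma growth_const_nonneg: "0 < \<alpha> \<Longrightarrow> \<alpha> < 1 \<Longrightarrow> 0 < S \<Longrightarrow> 0 \<le> growth_const \<alpha> S TYPE('d::finite)"
  by (auto simp: growth_const_def intro!: add_nonneg_nonneg mult_nonneg_nonneg)

lemma cut_velocity_growth:
  fixes m :: "(real^'d::finite) measure"
  assumes \<alpha>: "0 < \<alpha>" "\<alpha> < 1" and S: "0 < S" and m: "prob_space m" "sets m = sets borel"
    and chi: "cutoff_family chi" and R: "0 < R" and t: "t \<in> {0..1}"
  shows "norm (cut_velocity chi \<alpha> S R m x t) \<le> growth_const \<alpha> S TYPE('d) * (1 + norm x)"
proof -
  have "norm (cut_velocity chi \<alpha> S R m x t) \<le> 1 * norm (velocity \<alpha> S m x t)"
    unfolding cut_velocity_def norm_scaleR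
    by (intro mult_right_mono) (use chi R in \<open>auto simp: cutoff_family_def\<close>)
  then show ?thesis
    using velocity_growth[OF \<alpha> S refl m t, of x] by (simp add: growth_const_def)
qed

lemma cut_velocity_eq_0: "cutoff_family chi \<Longrightarrow> 0 < R \<Longrightarrow> 2 * R \<le> norm x \<Longrightarrow> cut_velocity chi \<alpha> S R m x t = 0"
  by (simp add: cut_velocity_def cutoff_family_def)

text \<open>Product rule on the ball of radius \<open>2 * R\<close>, where density, velocity and
  cutoff are controlled. \<open>K\<close> precedes \<open>m\<close>, so the bound passes to the
  supremum over all coefficients; including time yields joint continuity as well.\<close>

lemma cut_velocity_lipschitz:
  fixes chi :: "real \<Rightarrow> real^'d::finite \<Rightarrow> real"
  assumes \<alpha>: "0 < \<alpha>" "\<alpha> < 1" and S: "0 < S" and chi: "cutoff_family chi" and R: "0 < R"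
  shows "\<exists>K\<ge>0. \<forall>m x y. \<forall>s\<in>{0..1}. \<forall>t\<in>{0..1}. prob_space m \<longrightarrow> sets m = sets borel \<longrightarrow>
    norm (cut_velocity chi \<alpha> S R m x s - cut_velocity chi \<alpha> S R m y t) \<le> K * (norm (x - y) + \<bar>s - t\<bar>)"
proof -
  define r where "r = 2 * R"
  have r: "0 \<le> r" using R by (simp add: r_def)
  have "C_k 1 (chi R)" using chi R unfolding cutoff_family_def Cc_infinity_def by blast
  from C1_lipschitz_on_cball[OF this] obtain b where b: "0 \<le> b"
    "\<And>x y. x \<in> cball 0 r \<Longrightarrow> y \<in> cball 0 r \<Longrightarrow> \<bar>chi R x - chi R y\<bar> \<le> b * norm (x - y)" by metis
  obtain G where G: "G-lipschitz_on UNIV (gauss_density \<alpha> :: real^'d \<Rightarrow> real)"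
    using gauss_density_lipschitz[OF \<alpha>(1)] by blast
  define kappa where "kappa = 1 + 2 * S\<^sup>2 + 2 * real CARD('d)"
  define c where "c = (2 * pi * \<alpha>) powr (- real CARD('d) / 2)
      * exp (- (3 * (r\<^sup>2 + real CARD('d) + S\<^sup>2)) / (2 * \<alpha>))"
  have c: "0 < c" using \<alpha> by (simp add: c_def)
  define B where "B = growth_const \<alpha> S TYPE('d) * (1 + r)"
  have B: "0 \<le> B" using growth_const_nonneg[OF \<alpha> S, where 'd = 'd] r by (simp add: B_def)
  define K1 where "K1 = G * kappa * (1 + B) / c"
  have K1: "0 \<le> K1" using lipschitz_on_nonneg[OF G] B c by (simp add: K1_def kappa_def)
  define K where "K = K1 + b * B"
  have K: "0 \<le> K" using K1 b B by (simp add: K_def)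
  have inner: "norm (cut_velocity chi \<alpha> S R m x s - cut_velocity chi \<alpha> S R m y t) \<le> K * (norm (x - y) + \<bar>s - t\<bar>)"
    if x: "x \<in> cball 0 r" and y: "y \<in> cball 0 r" and st: "s \<in> {0..1}" "t \<in> {0..1}"
      and m: "prob_space m" "sets m = sets borel" for m x y s t
  proof -
    define \<Delta> where "\<Delta> = norm (x - y) + \<bar>s - t\<bar>"
    let ?v = "velocity \<alpha> S m"
    have vb: "norm (?v y t) \<le> B"
    proof -
      have "norm (?v y t) \<le> growth_const \<alpha> S TYPE('d) * (1 + norm y)"
        using velocity_growth[OF \<alpha> S refl m st(2), of y] by (simp add: growth_const_def)
      also have "\<dots> \<le> B" unfolding B_def
        using y growth_const_nonneg[OF \<alpha> S, where 'd = 'd] by (intro mult_left_mono) auto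
      finally show ?thesis .
    qed
    have rl: "c \<le> rho \<alpha> S m s x" unfolding c_def
      using rho_lower_bound[OF \<alpha> S refl m _ st(1), of x r] x by simp
    have lv: "norm (?v x s - ?v y t) \<le> K1 * \<Delta>"
      unfolding K1_def \<Delta>_def
      by (rule velocity_lipschitz[OF \<alpha> S kappa_def m G st c rl vb])
    have c1: "\<bar>chi R x\<bar> \<le> 1" using chi R by (auto simp: cutoff_family_def)
    have "cut_velocity chi \<alpha> S R m x s - cut_velocity chi \<alpha> S R m y t
        = chi R x *\<^sub>R (?v x s - ?v y t) + (chi R x - chi R y) *\<^sub>R ?v y t"
      by (simp add: cut_velocity_def algebra_simps)
    then have "norm (cut_velocity chi \<alpha> S R m x s - cut_velocity chi \<alpha> S R m y t)
        \<le> \<bar>chi R x\<bar> * norm (?v x s - ?v y t) + \<bar>chi R x - chi R y\<bar> * norm (?v y t)"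
      using norm_triangle_ineq[of "chi R x *\<^sub>R (?v x s - ?v y t)" "(chi R x - chi R y) *\<^sub>R ?v y t"] by simp
    also have "\<dots> \<le> 1 * (K1 * \<Delta>) + (b * norm (x - y)) * B"
      using c1 lv b(2)[OF x y] b(1) vb by (intro add_mono mult_mono) auto
    also have "\<dots> \<le> K1 * \<Delta> + (b * \<Delta>) * B"
      using b B by (auto simp: \<Delta>_def intro!: mult_right_mono mult_left_mono)
    finally show ?thesis by (simp add: K_def \<Delta>_def algebra_simps)
  qed
  have "norm (cut_velocity chi \<alpha> S R m x s - cut_velocity chi \<alpha> S R m y t) \<le> K * (norm (x - y) + \<bar>s - t\<bar>)"
    if st: "s \<in> {0..1}" "t \<in> {0..1}" and m: "prob_space m" "sets m = sets borel" for m x y s t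
  proof -
    \<comment> \<open>The field vanishes beyond \<open>r\<close>, hence is unchanged by the
      projection, and the bound on the ball extends to the whole space.\<close>
    let ?P = "closest_point (cball (0 :: real^'d) r)"
    note P = closest_point_cball_0[OF r]
    have cP: "cut_velocity chi \<alpha> S R m (?P z) u = cut_velocity chi \<alpha> S R m z u" for z u
      using closest_point_cball_0_supported[OF r, of "\<lambda>z. cut_velocity chi \<alpha> S R m z u"]
        cut_velocity_eq_0[OF chi R] by (simp add: r_def)
    have "norm (cut_velocity chi \<alpha> S R m (?P x) s - cut_velocity chi \<alpha> S R m (?P y) t)
        \<le> K * (norm (?P x - ?P y) + \<bar>s - t\<bar>)"
      by (intro inner P(1) st m)
    also have "\<dots> \<le> K * (norm (x - y) + \<bar>s - t\<bar>)"
      using P(4)[of x y] K by (intro mult_left_mono) (auto simp: dist_norm)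
    finally show ?thesis by (simp add: cP)
  qed
  then show ?thesis using K by blast
qed

lemma growth_field_cut_velocity:
  fixes chi :: "real \<Rightarrow> real^'d::finite \<Rightarrow> real"
  assumes \<alpha>: "0 < \<alpha>" "\<alpha> < 1" and S: "0 < S" and chi: "cutoff_family chi" and R: "0 < R"
    and m: "prob_space m" "sets m = sets borel"
  shows "growth_field (growth_const \<alpha> S TYPE('d)) (cut_velocity chi \<alpha> S R m)"
proof -
  from cut_velocity_lipschitz[OF \<alpha> S chi R] m obtain K where K: "0 \<le> K"
    "\<And>x y s t. s \<in> {0..1} \<Longrightarrow> t \<in> {0..1} \<Longrightarrow>
    norm (cut_velocity chi \<alpha> S R m x s - cut_velocity chi \<alpha> S R m y t) \<le> K * (norm (x - y) + \<bar>s - t\<bar>)"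
    by blast
  have "(2 * K)-lipschitz_on (UNIV \<times> {0..1}) (\<lambda>(x, t). cut_velocity chi \<alpha> S R m x t)"
  proof (rule lipschitz_onI)
    fix z w :: "(real^'d) \<times> real" assume zw: "z \<in> UNIV \<times> {0..1}" "w \<in> UNIV \<times> {0..1}"
    have "norm (cut_velocity chi \<alpha> S R m (fst z) (snd z) - cut_velocity chi \<alpha> S R m (fst w) (snd w))
        \<le> K * (norm (fst z - fst w) + \<bar>snd z - snd w\<bar>)"
      using zw by (intro K(2)) auto
    also have "\<dots> \<le> K * (dist z w + dist z w)"
      using K(1) dist_fst_le[of z w] dist_snd_le[of z w]
      by (intro mult_left_mono add_mono) (auto simp: dist_norm)
    finally show "dist (case z of (x, t) \<Rightarrow> cut_velocity chi \<alpha> S R m x t)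
        (case w of (x, t) \<Rightarrow> cut_velocity chi \<alpha> S R m x t) \<le> 2 * K * dist z w"
      by (simp add: case_prod_unfold dist_norm)
  qed (use K in auto)
  then have "continuous_on (UNIV \<times> {0..1}) (\<lambda>(x, t). cut_velocity chi \<alpha> S R m x t)"
    by (rule lipschitz_on_continuous_on)
  moreover have "K-lipschitz_on (cball 0 r) (\<lambda>x. cut_velocity chi \<alpha> S R m x t)" if "t \<in> {0..1}" for r t
    using K(2)[OF that that] K(1) by (auto intro!: lipschitz_onI simp: dist_norm)
  ultimately show ?thesis
    unfolding growth_field_def
    using growth_const_nonneg[OF \<alpha> S] cut_velocity_growth[OF \<alpha> S m chi R] by blast
qed

lemma Lip_le_iff:
  assumes "0 \<le> K"
  shows "Lip f \<le> ennreal K \<longleftrightarrow> K-lipschitz_on UNIV f"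
proof -
  have "ennreal (dist (f x) (f y) / dist x y) \<le> ennreal K \<longleftrightarrow> dist (f x) (f y) \<le> K * dist x y" for x y
    using assms by (cases "x = y") (auto simp: divide_le_eq)
  then show ?thesis
    using assms by (auto simp: Lip_def SUP_le_iff lipschitz_on_def)
qed

text \<open>Since \<open>enn2real\<close> sends infinity to 0, the exponent \<open>L\<close> of the
  theorem is a true Lipschitz constant only once the supremum is known to be finite.\<close>

lemma lip_const_finite:
  fixes chi :: "real \<Rightarrow> real^'d::finite \<Rightarrow> real"
  assumes \<alpha>: "0 < \<alpha>" "\<alpha> < 1" and S: "0 < S" and chi: "cutoff_family chi" and R: "0 < R"
    and m: "\<And>a. a \<in> A \<Longrightarrow> prob_space (\<mu> a) \<and> sets (\<mu> a) = sets borel"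
  shows "lip_const A \<mu> chi \<alpha> S R < \<infinity>"
proof -
  from cut_velocity_lipschitz[OF \<alpha> S chi R] obtain K where K: "0 \<le> K"
    "\<And>m x y s t. prob_space m \<Longrightarrow> sets m = sets borel \<Longrightarrow> s \<in> {0..1} \<Longrightarrow> t \<in> {0..1} \<Longrightarrow>
    norm (cut_velocity chi \<alpha> S R m x s - cut_velocity chi \<alpha> S R m y t) \<le> K * (norm (x - y) + \<bar>s - t\<bar>)"
    by blast
  have "Lip (\<lambda>x. cut_velocity chi \<alpha> S R (\<mu> a) x t) \<le> ennreal K" if "a \<in> A" "t \<in> {0..1}" for a t
    unfolding Lip_le_iff[OF K(1)]
    using K(2)[OF _ _ that(2) that(2)] m[OF that(1)] K(1) by (auto intro!: lipschitz_onI simp: dist_norm)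
  then have "lip_const A \<mu> chi \<alpha> S R \<le> ennreal K"
    unfolding lip_const_def by (intro SUP_least)
  then show ?thesis by (simp add: order_le_less_trans)
qed

lemma lip_const_lipschitz:
  assumes "lip_const A \<mu> chi \<alpha> S R < \<infinity>" "a \<in> A" "t \<in> {0..1}"
  shows "(enn2real (lip_const A \<mu> chi \<alpha> S R))-lipschitz_on UNIV (\<lambda>x. cut_velocity chi \<alpha> S R (\<mu> a) x t)"
proof -
  have "Lip (\<lambda>x. cut_velocity chi \<alpha> S R (\<mu> a) x t) \<le> lip_const A \<mu> chi \<alpha> S R"
    unfolding lip_const_def using assms(2,3) by (intro SUP_upper2[of a] SUP_upper2[of t]) auto
  also have "\<dots> = ennreal (enn2real (lip_const A \<mu> chi \<alpha> S R))" using assms(1) by simp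
  finally show ?thesis by (simp add: Lip_le_iff)
qed

section \<open>Couplings and the Wasserstein distance\<close>

lemma W2_leI:
  assumes c: "c \<in> couplings m n" and a: "0 \<le> a"
    and cost: "(\<integral>\<^sup>+z. ennreal ((dist (fst z) (snd z))\<^sup>2) \<partial>c) \<le> ennreal (a\<^sup>2)"
  shows "W2 m n \<le> ennreal a"
proof -
  define I where "I = (INF c\<in>couplings m n. \<integral>\<^sup>+z. ennreal ((dist (fst z) (snd z))\<^sup>2) \<partial>c)"
  have I: "I \<le> ennreal (a\<^sup>2)" unfolding I_def by (rule INF_lower2[OF c]) (rule cost)
  then have "I \<noteq> \<infinity>" by (auto simp: top_unique)
  moreover have "enn2real I \<le> a\<^sup>2" using enn2real_mono[OF I] by simp
  then have "sqrt (enn2real I) \<le> a" using a by (simp add: real_le_lsqrt)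
  ultimately show ?thesis
    unfolding W2_def I_def[symmetric] ennsqrt_def by (simp add: ennreal_leI)
qed

text \<open>No optimal coupling is constructed; a strict inequality leaves room for a near-optimal
  one, at the price of a slack in the final estimate.\<close>

lemma W2_lessE:
  assumes "W2 m n < ennreal e"
  obtains c where "c \<in> couplings m n"
    "(\<integral>\<^sup>+z. ennreal ((dist (fst z) (snd z))\<^sup>2) \<partial>c) \<le> ennreal (e\<^sup>2)"
proof -
  define I where "I = (INF c\<in>couplings m n. \<integral>\<^sup>+z. ennreal ((dist (fst z) (snd z))\<^sup>2) \<partial>c)"
  have *: "ennsqrt I < ennreal e" using assms by (simp add: W2_def I_def)
  then have I: "I \<noteq> \<infinity>" by (auto simp: ennsqrt_def)
  with * have "sqrt (enn2real I) < e" by (simp add: ennsqrt_def ennreal_less_iff)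
  then have "enn2real I < e\<^sup>2"
    by (metis enn2real_nonneg real_sqrt_ge_zero real_sqrt_pow2 power_strict_mono zero_less_numeral)
  then have "ennreal (enn2real I) < ennreal (e\<^sup>2)" by (simp add: ennreal_less_iff)
  then have "I < ennreal (e\<^sup>2)" using I by (simp add: top.not_eq_extremum)
  then show thesis unfolding I_def INF_less_iff using that by (auto intro: less_imp_le)
qed

text \<open>Minkowski's inequality, from \<open>(f + g)\<^sup>2 \<le> (A + B) (f\<^sup>2 / A + g\<^sup>2 / B)\<close>.\<close>
lemma nn_integral_square_add_le:
  fixes f g :: "'a \<Rightarrow> real"
  assumes [measurable]: "f \<in> borel_measurable M" "g \<in> borel_measurable M"
    and A: "0 < A" and B: "0 < B"
    and f: "(\<integral>\<^sup>+x. ennreal ((f x)\<^sup>2) \<partial>M) \<le> ennreal (A\<^sup>2)"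
    and g: "(\<integral>\<^sup>+x. ennreal ((g x)\<^sup>2) \<partial>M) \<le> ennreal (B\<^sup>2)"
  shows "(\<integral>\<^sup>+x. ennreal ((f x + g x)\<^sup>2) \<partial>M) \<le> ennreal ((A + B)\<^sup>2)"
proof -
  have "(\<integral>\<^sup>+x. ennreal ((f x + g x)\<^sup>2) \<partial>M)
      \<le> (\<integral>\<^sup>+x. ennreal ((A + B) / A) * ennreal ((f x)\<^sup>2) + ennreal ((A + B) / B) * ennreal ((g x)\<^sup>2) \<partial>M)"
  proof (rule nn_integral_mono)
    fix x
    have "(A + B) / A * (f x)\<^sup>2 + (A + B) / B * (g x)\<^sup>2 - (f x + g x)\<^sup>2 = (B * f x - A * g x)\<^sup>2 / (A * B)"
      using A B by (simp add: field_simps power2_eq_square)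
    moreover have "0 \<le> (B * f x - A * g x)\<^sup>2 / (A * B)" using A B by simp
    ultimately have "(f x + g x)\<^sup>2 \<le> (A + B) / A * (f x)\<^sup>2 + (A + B) / B * (g x)\<^sup>2" by linarith
    then show "ennreal ((f x + g x)\<^sup>2)
        \<le> ennreal ((A + B) / A) * ennreal ((f x)\<^sup>2) + ennreal ((A + B) / B) * ennreal ((g x)\<^sup>2)"
      using A B by (simp add: ennreal_mult'[symmetric] ennreal_plus[symmetric] ennreal_leI del: ennreal_plus)
  qed
  also have "\<dots> = ennreal ((A + B) / A) * (\<integral>\<^sup>+x. ennreal ((f x)\<^sup>2) \<partial>M)
      + ennreal ((A + B) / B) * (\<integral>\<^sup>+x. ennreal ((g x)\<^sup>2) \<partial>M)"
    by (subst nn_integral_add) (auto simp: nn_integral_cmult)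
  also have "\<dots> \<le> ennreal ((A + B) / A) * ennreal (A\<^sup>2) + ennreal ((A + B) / B) * ennreal (B\<^sup>2)"
    by (intro add_mono mult_left_mono f g) auto
  also have "\<dots> = ennreal ((A + B) / A * A\<^sup>2 + (A + B) / B * B\<^sup>2)"
    using A B by (simp add: ennreal_mult'[symmetric] ennreal_plus[symmetric] del: ennreal_plus)
  also have "(A + B) / A * A\<^sup>2 + (A + B) / B * B\<^sup>2 = (A + B)\<^sup>2"
    using A B by (simp add: field_simps power2_eq_square)
  finally show ?thesis .
qed

text \<open>The gluing lemma in the only case needed: the conditional law of the third coordinate given
  the first one has the explicit density \<open>k z / \<rho> z\<close> (Bayes), so no disintegration
  theorem is required.\<close>
lemma glue_density:
  fixes c :: "('a::euclidean_space \<times> 'a) measure" and m :: "'a measure"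
    and k :: "'a \<Rightarrow> 'a \<Rightarrow> real"
  assumes c: "prob_space c" "sets c = sets (borel \<Otimes>\<^sub>M borel)"
    and fst: "distr c borel fst = density lborel (\<lambda>z. ennreal (\<rho> z))"
    and m: "prob_space m" "sets m = sets borel"
    and k [measurable]: "case_prod k \<in> borel_measurable (borel \<Otimes>\<^sub>M borel)"
    and k0: "\<And>z x. 0 \<le> k z x" and \<rho>: "\<And>z. 0 < \<rho> z"
    and \<rho>k: "\<And>z. ennreal (\<rho> z) = (\<integral>\<^sup>+x. ennreal (k z x) \<partial>m)"
  obtains G where "sets G = sets ((borel \<Otimes>\<^sub>M borel) \<Otimes>\<^sub>M borel)"
    "\<And>f. f \<in> borel_measurable (borel \<Otimes>\<^sub>M borel) \<Longrightarrow> (\<integral>\<^sup>+\<omega>. f (fst \<omega>) \<partial>G) = (\<integral>\<^sup>+w. f w \<partial>c)"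
    "\<And>g. g \<in> borel_measurable (borel \<Otimes>\<^sub>M borel) \<Longrightarrow> (\<integral>\<^sup>+\<omega>. g (fst (fst \<omega>), snd \<omega>) \<partial>G)
      = (\<integral>\<^sup>+x. \<integral>\<^sup>+z. ennreal (k z x) * g (z, x) \<partial>lborel \<partial>m)"
proof -
  interpret c: prob_space c by (rule c)
  interpret m: prob_space m by (rule m)
  interpret lm: pair_sigma_finite "lborel :: 'a measure" m ..
  note [measurable_cong] = c(2) m(2)
  \<comment> \<open>Measurability of \<open>\<rho>\<close> is recovered from its representation as a
    parameter integral.\<close>
  have "(\<lambda>z. enn2real (\<integral>\<^sup>+x. ennreal (k z x) \<partial>m)) \<in> borel_measurable borel" by measurable
  then have [measurable]: "\<rho> \<in> borel_measurable borel"
    using \<rho> by (simp add: \<rho>k[symmetric] less_imp_le)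
  define K where "K \<omega> = ennreal (k (fst (fst \<omega>)) (snd \<omega>)) / ennreal (\<rho> (fst (fst \<omega>)))"
    for \<omega> :: "('a \<times> 'a) \<times> 'a"
  have K [measurable]: "K \<in> borel_measurable (c \<Otimes>\<^sub>M m)" unfolding K_def[abs_def] by measurable
  define G where "G = density (c \<Otimes>\<^sub>M m) K"
  have cancel: "a / ennreal (\<rho> z) * ennreal (\<rho> z) = a" for a z
    using \<rho>[of z] by (simp add: ennreal_divide_times ennreal_mult_divide_eq)
  have cancel': "ennreal (\<rho> z) * (a / ennreal (\<rho> z) * b) = a * b" for a b z
    using cancel[of a z] by (simp add: mult_ac)
  have sG: "sets G = sets ((borel \<Otimes>\<^sub>M borel) \<Otimes>\<^sub>M borel)"
    unfolding G_def sets_density by (intro sets_pair_measure_cong c m)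
  have i: "(\<integral>\<^sup>+\<omega>. f (fst \<omega>) \<partial>G) = (\<integral>\<^sup>+w. f w \<partial>c)"
    if [measurable]: "f \<in> borel_measurable (borel \<Otimes>\<^sub>M borel)" for f
  proof -
    have "(\<integral>\<^sup>+\<omega>. f (fst \<omega>) \<partial>G) = (\<integral>\<^sup>+\<omega>. K \<omega> * f (fst \<omega>) \<partial>(c \<Otimes>\<^sub>M m))"
      unfolding G_def by (rule nn_integral_density) measurable
    also have "\<dots> = (\<integral>\<^sup>+w. \<integral>\<^sup>+x. K (w, x) * f w \<partial>m \<partial>c)"
      by (subst m.nn_integral_fst[symmetric]) auto
    also have "\<dots> = (\<integral>\<^sup>+w. f w \<partial>c)"
    proof (rule nn_integral_cong)
      fix w
      have "(\<integral>\<^sup>+x. K (w, x) * f w \<partial>m) = (\<integral>\<^sup>+x. ennreal (k (fst w) x) \<partial>m) / ennreal (\<rho> (fst w)) * f w"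
        by (simp add: K_def nn_integral_multc nn_integral_divide)
      also have "\<dots> = f w"
        using \<rho>[of "fst w"] by (simp add: \<rho>k[symmetric] ennreal_divide_self)
      finally show "(\<integral>\<^sup>+x. K (w, x) * f w \<partial>m) = f w" .
    qed
    finally show ?thesis .
  qed
  have ii: "(\<integral>\<^sup>+\<omega>. g (fst (fst \<omega>), snd \<omega>) \<partial>G)
      = (\<integral>\<^sup>+x. \<integral>\<^sup>+z. ennreal (k z x) * g (z, x) \<partial>lborel \<partial>m)"
    if [measurable]: "g \<in> borel_measurable (borel \<Otimes>\<^sub>M borel)" for g
  proof -
    define h where "h z = (\<integral>\<^sup>+x. ennreal (k z x) / ennreal (\<rho> z) * g (z, x) \<partial>m)" for z
    have h [measurable]: "h \<in> borel_measurable borel" unfolding h_def[abs_def] by measurable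
    have "(\<integral>\<^sup>+\<omega>. g (fst (fst \<omega>), snd \<omega>) \<partial>G) = (\<integral>\<^sup>+\<omega>. K \<omega> * g (fst (fst \<omega>), snd \<omega>) \<partial>(c \<Otimes>\<^sub>M m))"
      unfolding G_def by (rule nn_integral_density) measurable
    also have "\<dots> = (\<integral>\<^sup>+w. h (fst w) \<partial>c)"
      by (subst m.nn_integral_fst[symmetric]) (auto simp: K_def h_def)
    also have "\<dots> = (\<integral>\<^sup>+z. h z \<partial>distr c borel fst)"
      by (subst nn_integral_distr) auto
    \<comment> \<open>The density of the first marginal of \<open>c\<close> cancels the denominator
      of the weight: the pair (z, x) gets the law k(z, x) dz m(dx), which no longer depends on
      \<open>c\<close>.\<close>
    also have "\<dots> = (\<integral>\<^sup>+z. ennreal (\<rho> z) * h z \<partial>lborel)"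
      unfolding fst by (subst nn_integral_density) auto
    also have "\<dots> = (\<integral>\<^sup>+z. \<integral>\<^sup>+x. ennreal (k z x) * g (z, x) \<partial>m \<partial>lborel)"
      unfolding h_def by (intro nn_integral_cong) (simp add: nn_integral_cmult[symmetric] cancel')
    also have "\<dots> = (\<integral>\<^sup>+x. \<integral>\<^sup>+z. ennreal (k z x) * g (z, x) \<partial>lborel \<partial>m)"
      by (rule lm.Fubini'[symmetric]) measurable
    finally show ?thesis .
  qed
  show thesis by (rule that[OF sG i ii])
qed

text \<open>Under \<open>G\<close> there are a mollified point \<open>z\<close>, a flow end point
  \<open>u\<close> and a stationary point \<open>x\<close>. As \<open>V\<close> undoes
  \<open>U\<close>, \<open>V u\<close> has law \<open>\<gamma>\<close>, so \<open>T (V u)\<close>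
  and \<open>x\<close> have the required marginals. The path T(V u), u, z, P x, x has four legs with
  root mean squares \<open>a\<close>, \<open>e\<close>, \<open>s\<close>, \<open>b\<close>, which
  Minkowski's inequality adds up.\<close>

lemma W2_chain_le:
  fixes \<gamma> m :: "'a::euclidean_space measure" and k :: "'a \<Rightarrow> 'a \<Rightarrow> real" and P T U V :: "'a \<Rightarrow> 'a"
  assumes \<gamma>: "prob_space \<gamma>" "sets \<gamma> = sets borel" and m: "prob_space m" "sets m = sets borel"
    and [measurable]: "T \<in> borel_measurable borel" "U \<in> borel_measurable borel" "V \<in> borel_measurable borel"
      "P \<in> borel_measurable borel" "case_prod k \<in> borel_measurable (borel \<Otimes>\<^sub>M borel)"
    and VU: "\<And>x. V (U x) = x"
    and k0: "\<And>z x. 0 \<le> k z x" and \<rho>: "\<And>z. 0 < \<rho> z"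
    and \<rho>k: "\<And>z. ennreal (\<rho> z) = (\<integral>\<^sup>+x. ennreal (k z x) \<partial>m)"
    and k1: "\<And>x. (\<integral>\<^sup>+z. ennreal (k z x) \<partial>lborel) = 1"
    and pos: "0 < a" "0 < e" "0 < s" "0 < b"
    and TU: "(\<integral>\<^sup>+x. ennreal ((dist (T x) (U x))\<^sup>2) \<partial>\<gamma>) \<le> ennreal (a\<^sup>2)"
    and W: "W2 (density lborel (\<lambda>z. ennreal (\<rho> z))) (distr \<gamma> borel U) < ennreal e"
    and k2: "\<And>x. (\<integral>\<^sup>+z. ennreal (k z x) * ennreal ((dist z (P x))\<^sup>2) \<partial>lborel) \<le> ennreal (s\<^sup>2)"
    and Pm: "(\<integral>\<^sup>+x. ennreal ((dist (P x) x)\<^sup>2) \<partial>m) \<le> ennreal (b\<^sup>2)"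
  shows "W2 (distr \<gamma> borel T) m \<le> ennreal (a + e + s + b)"
proof -
  interpret \<gamma>: prob_space \<gamma> by (rule \<gamma>)
  interpret m: prob_space m by (rule m)
  note [measurable_cong] = \<gamma>(2) m(2)
  obtain c where c: "c \<in> couplings (density lborel (\<lambda>z. ennreal (\<rho> z))) (distr \<gamma> borel U)"
    and ce: "(\<integral>\<^sup>+z. ennreal ((dist (fst z) (snd z))\<^sup>2) \<partial>c) \<le> ennreal (e\<^sup>2)"
    by (rule W2_lessE[OF W])
  have pc: "prob_space c" and sc: "sets c = sets (borel \<Otimes>\<^sub>M borel)"
    and c1: "distr c borel fst = density lborel (\<lambda>z. ennreal (\<rho> z))"
    and c2: "distr c borel snd = distr \<gamma> borel U"
    using c by (auto simp: couplings_def)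
  note [measurable_cong] = sc
  obtain G where sG: "sets G = sets ((borel \<Otimes>\<^sub>M borel) \<Otimes>\<^sub>M borel)"
    and G1: "\<And>f. f \<in> borel_measurable (borel \<Otimes>\<^sub>M borel) \<Longrightarrow> (\<integral>\<^sup>+\<omega>. f (fst \<omega>) \<partial>G) = (\<integral>\<^sup>+w. f w \<partial>c)"
    and G2: "\<And>g. g \<in> borel_measurable (borel \<Otimes>\<^sub>M borel) \<Longrightarrow> (\<integral>\<^sup>+\<omega>. g (fst (fst \<omega>), snd \<omega>) \<partial>G)
      = (\<integral>\<^sup>+x. \<integral>\<^sup>+z. ennreal (k z x) * g (z, x) \<partial>lborel \<partial>m)"
    by (rule glue_density[OF pc sc c1 m _ k0 \<rho> \<rho>k]) auto
  note [measurable_cong] = sG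
  have Gu: "(\<integral>\<^sup>+\<omega>. f (snd (fst \<omega>)) \<partial>G) = (\<integral>\<^sup>+x. f (U x) \<partial>\<gamma>)"
    if [measurable]: "f \<in> borel_measurable borel" for f
  proof -
    have "(\<integral>\<^sup>+\<omega>. f (snd (fst \<omega>)) \<partial>G) = (\<integral>\<^sup>+w. f (snd w) \<partial>c)" by (rule G1) measurable
    also have "\<dots> = (\<integral>\<^sup>+u. f u \<partial>distr c borel snd)" by (subst nn_integral_distr) auto
    also have "\<dots> = (\<integral>\<^sup>+x. f (U x) \<partial>\<gamma>)" unfolding c2 by (subst nn_integral_distr) auto
    finally show ?thesis .
  qed
  have Gx: "(\<integral>\<^sup>+\<omega>. f (snd \<omega>) \<partial>G) = (\<integral>\<^sup>+x. f x \<partial>m)"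
    if [measurable]: "f \<in> borel_measurable borel" for f
  proof -
    have "(\<integral>\<^sup>+\<omega>. f (snd \<omega>) \<partial>G) = (\<integral>\<^sup>+x. \<integral>\<^sup>+z. ennreal (k z x) * f x \<partial>lborel \<partial>m)"
      using G2[of "\<lambda>w. f (snd w)"] by simp
    also have "\<dots> = (\<integral>\<^sup>+x. f x \<partial>m)" by (intro nn_integral_cong) (simp add: nn_integral_multc k1)
    finally show ?thesis .
  qed
  let ?F = "\<lambda>\<omega>. (T (V (snd (fst \<omega>))), snd \<omega>)"
  have F [measurable]: "?F \<in> measurable G (borel \<Otimes>\<^sub>M borel)" by measurable
  have "emeasure G (space G) = 1"
    using Gx[of "\<lambda>_. 1"] by (simp add: m.emeasure_space_1)
  then interpret G: prob_space G by (rule prob_spaceI)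
  have "distr G (borel \<Otimes>\<^sub>M borel) ?F \<in> couplings (distr \<gamma> borel T) m"
    unfolding couplings_def
  proof (intro CollectI conjI)
    show "prob_space (distr G (borel \<Otimes>\<^sub>M borel) ?F)" by (rule G.prob_space_distr) measurable
    show "distr (distr G (borel \<Otimes>\<^sub>M borel) ?F) borel fst = distr \<gamma> borel T"
    proof (rule measure_eqI)
      fix A assume "A \<in> sets (distr (distr G (borel \<Otimes>\<^sub>M borel) ?F) borel fst)"
      then have [measurable]: "A \<in> sets borel" by simp
      have "emeasure (distr (distr G (borel \<Otimes>\<^sub>M borel) ?F) borel fst) A
          = (\<integral>\<^sup>+y. indicator A y \<partial>distr (distr G (borel \<Otimes>\<^sub>M borel) ?F) borel fst)" by simp
      also have "\<dots> = (\<integral>\<^sup>+\<omega>. indicator A (T (V (snd (fst \<omega>)))) \<partial>G)"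
        by (simp add: nn_integral_distr del: nn_integral_indicator)
      also have "\<dots> = (\<integral>\<^sup>+x. indicator A (T x) \<partial>\<gamma>)" by (subst Gu) (auto simp: VU)
      also have "\<dots> = (\<integral>\<^sup>+y. indicator A y \<partial>distr \<gamma> borel T)"
        by (simp add: nn_integral_distr del: nn_integral_indicator)
      also have "\<dots> = emeasure (distr \<gamma> borel T) A" by simp
      finally show "emeasure (distr (distr G (borel \<Otimes>\<^sub>M borel) ?F) borel fst) A = emeasure (distr \<gamma> borel T) A" .
    qed simp
    show "distr (distr G (borel \<Otimes>\<^sub>M borel) ?F) borel snd = m"
    proof (rule measure_eqI)
      fix A assume "A \<in> sets (distr (distr G (borel \<Otimes>\<^sub>M borel) ?F) borel snd)"
      then have [measurable]: "A \<in> sets borel" by simp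
      have "emeasure (distr (distr G (borel \<Otimes>\<^sub>M borel) ?F) borel snd) A
          = (\<integral>\<^sup>+y. indicator A y \<partial>distr (distr G (borel \<Otimes>\<^sub>M borel) ?F) borel snd)" by simp
      also have "\<dots> = (\<integral>\<^sup>+\<omega>. indicator A (snd \<omega>) \<partial>G)"
        by (simp add: nn_integral_distr del: nn_integral_indicator)
      also have "\<dots> = (\<integral>\<^sup>+x. indicator A x \<partial>m)" by (rule Gx) measurable
      also have "\<dots> = emeasure m A" by simp
      finally show "emeasure (distr (distr G (borel \<Otimes>\<^sub>M borel) ?F) borel snd) A = emeasure m A" .
    qed (simp add: m)
  qed simp
  then show ?thesis
  proof (rule W2_leI)
    show "0 \<le> a + e + s + b" using pos by simp
    let ?z = "\<lambda>\<omega> :: ('a \<times> 'a) \<times> 'a. fst (fst \<omega>)" and ?u = "\<lambda>\<omega> :: ('a \<times> 'a) \<times> 'a. snd (fst \<omega>)"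
    define f1 where "f1 \<omega> = dist (T (V (?u \<omega>))) (?u \<omega>)" for \<omega>
    define f2 where "f2 \<omega> = dist (?u \<omega>) (?z \<omega>)" for \<omega>
    define f3 where "f3 \<omega> = dist (?z \<omega>) (P (snd \<omega>))" for \<omega>
    define f4 where "f4 \<omega> = dist (P (snd \<omega>)) (snd \<omega>)" for \<omega> :: "('a \<times> 'a) \<times> 'a"
    have [measurable]: "f1 \<in> borel_measurable G" "f2 \<in> borel_measurable G"
        "f3 \<in> borel_measurable G" "f4 \<in> borel_measurable G"
      unfolding f1_def[abs_def] f2_def[abs_def] f3_def[abs_def] f4_def[abs_def] by measurable
    have b1: "(\<integral>\<^sup>+\<omega>. ennreal ((f1 \<omega>)\<^sup>2) \<partial>G) \<le> ennreal (a\<^sup>2)"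
      unfolding f1_def by (subst Gu[of "\<lambda>u. ennreal ((dist (T (V u)) u)\<^sup>2)"]) (use TU in \<open>auto simp: VU\<close>)
    have b2: "(\<integral>\<^sup>+\<omega>. ennreal ((f2 \<omega>)\<^sup>2) \<partial>G) \<le> ennreal (e\<^sup>2)"
      unfolding f2_def by (subst G1[of "\<lambda>w. ennreal ((dist (snd w) (fst w))\<^sup>2)"]) (use ce in \<open>auto simp: dist_commute\<close>)
    have b3: "(\<integral>\<^sup>+\<omega>. ennreal ((f3 \<omega>)\<^sup>2) \<partial>G) \<le> ennreal (s\<^sup>2)"
    proof -
      have "(\<integral>\<^sup>+\<omega>. ennreal ((f3 \<omega>)\<^sup>2) \<partial>G)
          = (\<integral>\<^sup>+x. \<integral>\<^sup>+z. ennreal (k z x) * ennreal ((dist z (P x))\<^sup>2) \<partial>lborel \<partial>m)"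
        unfolding f3_def using G2[of "\<lambda>w. ennreal ((dist (fst w) (P (snd w)))\<^sup>2)"] by simp
      also have "\<dots> \<le> (\<integral>\<^sup>+x. ennreal (s\<^sup>2) \<partial>m)" by (intro nn_integral_mono k2)
      finally show ?thesis by (simp add: m.emeasure_space_1)
    qed
    have b4: "(\<integral>\<^sup>+\<omega>. ennreal ((f4 \<omega>)\<^sup>2) \<partial>G) \<le> ennreal (b\<^sup>2)"
      unfolding f4_def by (subst Gx[of "\<lambda>x. ennreal ((dist (P x) x)\<^sup>2)"]) (use Pm in auto)
    have "(\<integral>\<^sup>+z. ennreal ((dist (fst z) (snd z))\<^sup>2) \<partial>distr G (borel \<Otimes>\<^sub>M borel) ?F)
        = (\<integral>\<^sup>+\<omega>. ennreal ((dist (T (V (?u \<omega>))) (snd \<omega>))\<^sup>2) \<partial>G)"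
      by (subst nn_integral_distr) auto
    also have "\<dots> \<le> (\<integral>\<^sup>+\<omega>. ennreal ((f1 \<omega> + f2 \<omega> + f3 \<omega> + f4 \<omega>)\<^sup>2) \<partial>G)"
    proof (intro nn_integral_mono ennreal_leI power_mono)
      fix \<omega>
      show "dist (T (V (?u \<omega>))) (snd \<omega>) \<le> f1 \<omega> + f2 \<omega> + f3 \<omega> + f4 \<omega>"
        unfolding f1_def f2_def f3_def f4_def
        using dist_triangle[of "T (V (?u \<omega>))" "snd \<omega>" "?u \<omega>"] dist_triangle[of "?u \<omega>" "snd \<omega>" "?z \<omega>"]
          dist_triangle[of "?z \<omega>" "snd \<omega>" "P (snd \<omega>)"] by linarith
    qed simp
    also have "\<dots> \<le> ennreal ((a + e + s + b)\<^sup>2)"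
      using pos by (intro nn_integral_square_add_le b1 b2 b3 b4 borel_measurable_add) auto
    finally show "(\<integral>\<^sup>+z. ennreal ((dist (fst z) (snd z))\<^sup>2) \<partial>distr G (borel \<Otimes>\<^sub>M borel) ?F)
        \<le> ennreal ((a + e + s + b)\<^sup>2)" .
  qed
qed

section \<open>The error estimate\<close>

lemma growth_field_mono:
  assumes v: "growth_field C v" and "C \<le> D"
  shows "growth_field D v"
proof -
  have "norm (v x t) \<le> D * (1 + norm x)" if "t \<in> {0..1}" for x t
  proof -
    have "norm (v x t) \<le> C * (1 + norm x)" using v that by (simp add: growth_field_def)
    also have "\<dots> \<le> D * (1 + norm x)" using \<open>C \<le> D\<close> by (intro mult_right_mono) auto
    finally show ?thesis .
  qed
  then show ?thesis using v \<open>C \<le> D\<close> by (auto simp: growth_field_def)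
qed

text \<open>Trajectories of \<open>w\<close> that might leave the ball of radius \<open>R\<close> start outside the ball of radius
  \<open>R / H - 1\<close>; for them the second summand dominates.\<close>
lemma terminal_map_difference:
  fixes v w :: "real^'d::finite \<Rightarrow> real \<Rightarrow> real^'d"
  assumes v: "growth_field C v" and w: "growth_field C w" and R: "0 < R" and p: "2 < p"
    and e: "d * exp L \<le> R"
    and lip: "\<And>t. t \<in> {0..1} \<Longrightarrow> L-lipschitz_on UNIV (\<lambda>x. w x t)"
    and supp: "\<And>x t. 2 * R \<le> norm x \<Longrightarrow> t \<in> {0..1} \<Longrightarrow> w x t = 0"
    and d: "\<And>x t. norm x \<le> 2 * R \<Longrightarrow> t \<in> {0..1} \<Longrightarrow> norm (v x t - w x t) \<le> d"
  defines "H \<equiv> (1 + C) * exp C"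
  shows "(norm (terminal_map v x - terminal_map w x))\<^sup>2
    \<le> (d * exp L)\<^sup>2 + 4 * H powr p * R powr (- (p - 2)) * (1 + norm x) powr p"
proof -
  have C: "0 \<le> C" using v by (simp add: growth_field_def)
  have H: "0 < H" using C by (simp add: H_def)
  \<comment> \<open>A common bound for the trajectories of both fields from \<open>x\<close>, built
    from the growth constant only.\<close>
  define h where "h = H * (1 + norm x)"
  have h: "0 < h" using H by (auto simp: h_def intro!: mult_pos_pos add_pos_nonneg)
  have hb: "(norm x + C) * exp C \<le> h"
    using C unfolding h_def H_def by (simp add: algebra_simps)
  have tail: "4 * H powr p * R powr (- (p - 2)) * (1 + norm x) powr p = 4 * h powr p * R powr (- (p - 2))"
    using H by (simp add: h_def powr_mult)
  show ?thesis
  proof (cases "h \<le> R")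
    case True
    have "norm (terminal_map v x - terminal_map w x) \<le> d * exp L"
      by (rule terminal_map_stability[OF v w _ e lip supp d]) (use True hb R in auto)
    then have "(norm (terminal_map v x - terminal_map w x))\<^sup>2 \<le> (d * exp L)\<^sup>2" by (intro power_mono) auto
    then show ?thesis unfolding tail by (rule order_trans) simp
  next
    case False
    have "norm (terminal_map v x - terminal_map w x) \<le> norm (terminal_map v x) + norm (terminal_map w x)"
      by (rule norm_triangle_ineq4)
    also have "\<dots> \<le> 2 * h"
      using terminal_map_bound[OF v, of x] terminal_map_bound[OF w, of x] hb by linarith
    finally have "(norm (terminal_map v x - terminal_map w x))\<^sup>2 \<le> (2 * h)\<^sup>2" by (intro power_mono) auto
    also have "\<dots> = 4 * h powr 2 * 1" using h by (simp add: powr_numeral power_mult_distrib)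
    \<comment> \<open>As \<open>h > R\<close>, the inserted factor is at least 1; it trades moments
      of the starting point for decay in \<open>R\<close>.\<close>
    also have "\<dots> \<le> 4 * h powr 2 * (h / R) powr (p - 2)"
      using False h R p by (intro mult_left_mono ge_one_powr_ge_zero) auto
    also have "(h / R) powr (p - 2) = h powr (p - 2) * R powr (- (p - 2))"
      using h R by (subst powr_divide) (simp_all only: powr_minus divide_inverse less_imp_le)
    also have "4 * h powr 2 * (h powr (p - 2) * R powr (- (p - 2))) = 4 * h powr p * R powr (- (p - 2))"
      by (simp add: powr_add[symmetric])
    finally show ?thesis unfolding tail by (rule order_trans) simp
  qed
qed

text \<open>Only points with |x| > S move, by less than |x|, and there |x|^2 \<le> |x|^q S^(-(q-2)).
  The \<open>max\<close> matches \<open>ennreal\<close>, which clips a negative \<open>M\<close> to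
  0.\<close>

lemma radial_proj_moment:
  fixes m :: "'a::euclidean_space measure"
  assumes S: "0 < S" and q: "2 < q" and m: "sets m = sets borel"
    and M: "(\<integral>\<^sup>+x. ennreal (norm x powr q) \<partial>m) \<le> ennreal M"
  shows "(\<integral>\<^sup>+x. ennreal ((dist (radial_proj S x) x)\<^sup>2) \<partial>m) \<le> ennreal (max 0 M * S powr (- (q - 2)))"
proof -
  note [measurable_cong] = m
  have "(\<integral>\<^sup>+x. ennreal ((dist (radial_proj S x) x)\<^sup>2) \<partial>m)
      \<le> (\<integral>\<^sup>+x. ennreal (norm x powr q) * ennreal (S powr (- (q - 2))) \<partial>m)"
  proof (intro nn_integral_mono)
    fix x :: 'a
    have "(dist (radial_proj S x) x)\<^sup>2 \<le> norm x powr q * S powr (- (q - 2))"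
    proof (cases "norm x \<le> S")
      case False
      then have x: "0 < norm x" "S < norm x" using S by auto
      have "radial_proj S x - x = - ((norm x - S) / norm x) *\<^sub>R x"
        using False x by (simp add: radial_proj_def diff_divide_distrib algebra_simps)
      then have "dist (radial_proj S x) x = norm x - S" using x by (simp add: dist_norm)
      then have "(dist (radial_proj S x) x)\<^sup>2 \<le> (norm x)\<^sup>2" using x S by (intro power_mono) auto
      also have "\<dots> = norm x powr q * norm x powr (- (q - 2))"
        using x by (simp add: powr_add[symmetric] powr_numeral)
      also have "\<dots> \<le> norm x powr q * S powr (- (q - 2))"
        using x S q by (intro mult_left_mono powr_mono2') auto
      finally show ?thesis .
    qed (simp add: radial_proj_def)
    then show "ennreal ((dist (radial_proj S x) x)\<^sup>2) \<le> ennreal (norm x powr q) * ennreal (S powr (- (q - 2)))"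
      by (simp add: ennreal_mult'[symmetric] ennreal_leI)
  qed
  also have "\<dots> = (\<integral>\<^sup>+x. ennreal (norm x powr q) \<partial>m) * ennreal (S powr (- (q - 2)))"
    by (intro nn_integral_multc) measurable
  also have "\<dots> \<le> ennreal (max 0 M) * ennreal (S powr (- (q - 2)))"
    using M by (intro mult_right_mono order_trans[OF M] ennreal_leI) auto
  finally show ?thesis by (simp add: ennreal_mult')
qed

text \<open>The estimate for a single coefficient, with \<open>\<eta>\<close> for the truncation
  error and \<open>q\<close> for \<open>p\<^sub>0\<close>. It applies \<open>W2_chain_le\<close> to
  the Gaussian kernel centred at the projected stationary point.\<close>

lemma terminal_law_W2_le:
  fixes m :: "(real^'d::finite) measure" and v :: "real^'d \<Rightarrow> real \<Rightarrow> real^'d"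
    and chi :: "real \<Rightarrow> real^'d \<Rightarrow> real"
  assumes \<alpha>: "0 < \<alpha>" "\<alpha> < 1" and S: "0 < S" and m: "prob_space m" "sets m = sets borel"
    and chi: "cutoff_family chi" and R: "0 < R" and p: "2 < p" and q: "2 < q"
    and C: "growth_const \<alpha> S TYPE('d) \<le> C" and v: "growth_field C v"
    and L: "\<And>t. t \<in> {0..1} \<Longrightarrow> L-lipschitz_on UNIV (\<lambda>x. cut_velocity chi \<alpha> S R m x t)"
    and d: "\<And>x t. norm x \<le> 2 * R \<Longrightarrow> t \<in> {0..1} \<Longrightarrow> norm (v x t - cut_velocity chi \<alpha> S R m x t) \<le> d"
    and e: "d * exp L \<le> R"
    and D: "ennreal (4 * ((1 + C) * exp C) powr p) * (\<integral>\<^sup>+x. ennreal ((1 + norm x) powr p) \<partial>(gauss 1 :: (real^'d) measure))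
      \<le> ennreal (D\<^sup>2)" "0 \<le> D"
    and M: "(\<integral>\<^sup>+x. ennreal (norm x powr q) \<partial>m) \<le> ennreal M"
    and W: "W2 (rho_measure \<alpha> S m 1) (terminal_law (cut_velocity chi \<alpha> S R m)) \<le> \<eta>"
  shows "W2 (terminal_law v) m \<le> ennreal (exp L) * ennreal d + ennreal (D * R powr (- (p - 2) / 2)) + \<eta>
    + ennreal (sqrt (\<alpha> * real CARD('d))) + ennreal (sqrt M * S powr (- (q - 2) / 2))"
proof (rule ennreal_le_epsilon)
  fix \<epsilon> :: real
  assume fin: "ennreal (exp L) * ennreal d + ennreal (D * R powr (- (p - 2) / 2)) + \<eta>
    + ennreal (sqrt (\<alpha> * real CARD('d))) + ennreal (sqrt M * S powr (- (q - 2) / 2)) < top" and \<epsilon>: "0 < \<epsilon>"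
  let ?w = "cut_velocity chi \<alpha> S R m"
  let ?T = "terminal_map v" and ?U = "terminal_map ?w" and ?V = "terminal_map (\<lambda>x t. - ?w x (1 - t))"
  have w: "growth_field C ?w"
    by (rule growth_field_mono[OF growth_field_cut_velocity[OF \<alpha> S chi R m] C])
  have C0: "0 \<le> C" using v by (simp add: growth_field_def)
  have d0: "0 \<le> d" using d[of 0 0] R by (auto intro: order_trans[OF norm_ge_zero])
  have [measurable]: "?T \<in> borel_measurable borel" "?U \<in> borel_measurable borel" "?V \<in> borel_measurable borel"
    using continuous_on_terminal_map v w reversed_growth_field[OF w]
    by (auto intro!: borel_measurable_continuous_onI)
  have sq: "(x powr (- y / 2))\<^sup>2 = x powr (- y)" for x y :: real
    by (simp add: power2_eq_square flip: powr_add)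
  define tail where "tail = D * R powr (- (p - 2) / 2)"
  define trunc where "trunc = sqrt (max 0 M) * S powr (- (q - 2) / 2)"
  have tail: "0 \<le> tail" "tail\<^sup>2 = D\<^sup>2 * R powr (- (p - 2))"
    using D(2) by (simp_all only: tail_def power_mult_distrib sq mult_nonneg_nonneg powr_ge_zero)
  have trunc: "0 \<le> trunc" "trunc\<^sup>2 = max 0 M * S powr (- (q - 2))"
    unfolding trunc_def power_mult_distrib sq by simp_all
  \<comment> \<open>Finiteness is supplied by \<open>ennreal_le_epsilon\<close>; an infinite
    right-hand side needs no argument.\<close>
  have \<eta>: "\<eta> = ennreal (enn2real \<eta>)" using fin by (auto simp: less_top)
  \<comment> \<open>The shares of \<epsilon> make \<open>a\<close> and \<open>b\<close> strictly
    positive, as \<open>W2_chain_le\<close> requires, and put \<open>e'\<close> strictly above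
    \<open>\<eta>\<close> so that a near-optimal coupling exists.\<close>
  define a e' s b where "a = d * exp L + tail + \<epsilon> / 3" and "e' = enn2real \<eta> + \<epsilon> / 3"
    and "s = sqrt (\<alpha> * real CARD('d))" and "b = trunc + \<epsilon> / 3"
  have W': "W2 (density lborel (\<lambda>z. ennreal (rho \<alpha> S m 1 z))) (distr (gauss 1) borel ?U) < ennreal e'"
  proof -
    have "\<eta> < ennreal e'" using \<epsilon> by (subst \<eta>) (simp add: e'_def ennreal_less_iff)
    with W show ?thesis by (simp add: rho_measure_def terminal_law_def)
  qed
  have TU: "(\<integral>\<^sup>+x. ennreal ((dist (?T x) (?U x))\<^sup>2) \<partial>gauss 1) \<le> ennreal (a\<^sup>2)"
  proof -
    define c where "c = 4 * ((1 + C) * exp C) powr p * R powr (- (p - 2))"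
    interpret g: prob_space "gauss 1 :: (real^'d) measure" by (rule prob_space_gauss) simp
    have meas: "(\<lambda>x. ennreal ((1 + norm x) powr p)) \<in> borel_measurable (gauss 1 :: (real^'d) measure)"
      unfolding measurable_cong_sets[OF sets_gauss refl] by measurable
    have "(\<integral>\<^sup>+x. ennreal ((dist (?T x) (?U x))\<^sup>2) \<partial>gauss 1)
        \<le> (\<integral>\<^sup>+x. ennreal ((d * exp L)\<^sup>2) + ennreal c * ennreal ((1 + norm x) powr p) \<partial>(gauss 1 :: (real^'d) measure))"
    proof (intro nn_integral_mono)
      fix x :: "real^'d"
      have "(dist (?T x) (?U x))\<^sup>2 \<le> (d * exp L)\<^sup>2 + c * (1 + norm x) powr p"
        unfolding dist_norm c_def
        by (rule terminal_map_difference[OF v w R p e L cut_velocity_eq_0[OF chi R] d])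
      then show "ennreal ((dist (?T x) (?U x))\<^sup>2) \<le> ennreal ((d * exp L)\<^sup>2) + ennreal c * ennreal ((1 + norm x) powr p)"
        by (simp add: c_def ennreal_mult'[symmetric] ennreal_plus[symmetric] ennreal_leI del: ennreal_plus)
    qed
    also have "\<dots> = ennreal ((d * exp L)\<^sup>2) + ennreal c * (\<integral>\<^sup>+x. ennreal ((1 + norm x) powr p) \<partial>(gauss 1 :: (real^'d) measure))"
      using meas g.emeasure_space_1
      by (subst nn_integral_add) (simp_all add: nn_integral_cmult)
    also have "ennreal c = ennreal (R powr (- (p - 2))) * ennreal (4 * ((1 + C) * exp C) powr p)"
      by (simp add: c_def ennreal_mult'[symmetric] mult.commute)
    also have "ennreal ((d * exp L)\<^sup>2) + ennreal (R powr (- (p - 2))) * ennreal (4 * ((1 + C) * exp C) powr p)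
        * (\<integral>\<^sup>+x. ennreal ((1 + norm x) powr p) \<partial>(gauss 1 :: (real^'d) measure))
        \<le> ennreal ((d * exp L)\<^sup>2) + ennreal (R powr (- (p - 2))) * ennreal (D\<^sup>2)"
      unfolding mult.assoc[of "ennreal (R powr (- (p - 2)))"] by (intro add_left_mono mult_left_mono D) auto
    also have "\<dots> = ennreal ((d * exp L)\<^sup>2 + tail\<^sup>2)"
      by (simp add: tail ennreal_mult'[symmetric] ennreal_plus[symmetric] mult.commute del: ennreal_plus)
    also have "\<dots> \<le> ennreal (a\<^sup>2)"
    proof (intro ennreal_leI)
      have "(d * exp L)\<^sup>2 + tail\<^sup>2 \<le> (d * exp L + tail)\<^sup>2"
        using d0 tail(1) by (simp add: power2_sum)
      also have "\<dots> \<le> a\<^sup>2" unfolding a_def using d0 tail(1) \<epsilon> by (intro power_mono) auto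
      finally show "(d * exp L)\<^sup>2 + tail\<^sup>2 \<le> a\<^sup>2" .
    qed
    finally show ?thesis .
  qed
  have k1: "(\<integral>\<^sup>+z. ennreal (gauss_density \<alpha> (z - radial_proj S x)) \<partial>lborel) = 1" for x :: "real^'d"
    using \<alpha> by (simp add: nn_integral_lborel_shift[of "\<lambda>z. ennreal (gauss_density \<alpha> z)"] nn_integral_gauss_density)
  have k2: "(\<integral>\<^sup>+z. ennreal (gauss_density \<alpha> (z - radial_proj S x)) * ennreal ((dist z (radial_proj S x))\<^sup>2) \<partial>lborel)
      \<le> ennreal (s\<^sup>2)" for x :: "real^'d"
    using \<alpha> nn_integral_lborel_shift[of "\<lambda>z :: real^'d. ennreal (gauss_density \<alpha> z * (norm z)\<^sup>2)" "radial_proj S x"]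
    by (simp add: s_def ennreal_mult'[symmetric] dist_norm gauss_second_moment)
  have Pm: "(\<integral>\<^sup>+x. ennreal ((dist (radial_proj S x) x)\<^sup>2) \<partial>m) \<le> ennreal (b\<^sup>2)"
  proof -
    have "(\<integral>\<^sup>+x. ennreal ((dist (radial_proj S x) x)\<^sup>2) \<partial>m) \<le> ennreal (trunc\<^sup>2)"
      unfolding trunc(2) by (rule radial_proj_moment[OF S q m(2) M])
    also have "\<dots> \<le> ennreal (b\<^sup>2)"
      unfolding b_def using trunc(1) \<epsilon> by (intro ennreal_leI power_mono) auto
    finally show ?thesis .
  qed
  have "W2 (distr (gauss 1) borel ?T) m \<le> ennreal (a + e' + s + b)"
  proof (rule W2_chain_le[OF _ _ m, where U = ?U and V = ?V and P = "radial_proj S"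
        and k = "\<lambda>z x. gauss_density \<alpha> (z - radial_proj S x)" and \<rho> = "rho \<alpha> S m 1"])
    show "?V (?U x) = x" for x by (rule terminal_map_reversed[OF w])
    show "0 < rho \<alpha> S m 1 z" for z by (rule rho_pos[OF \<alpha> S refl m]) simp
    show "ennreal (rho \<alpha> S m 1 z) = (\<integral>\<^sup>+x. ennreal (gauss_density \<alpha> (z - radial_proj S x)) \<partial>m)" for z
      by (rule ennreal_rho_1[OF \<alpha> S refl m])
    show "0 < a" "0 < e'" "0 < b"
      using d0 tail(1) trunc(1) \<epsilon> by (auto simp: a_def e'_def b_def intro!: add_nonneg_pos add_nonneg_nonneg)
    show "0 < s" using \<alpha> by (simp add: s_def)
  qed (use TU W' k1 k2 Pm prob_space_gauss[of 1] in auto)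
  also have "ennreal (a + e' + s + b)
      = ennreal (d * exp L + tail + enn2real \<eta> + s + trunc + \<epsilon>)"
    by (rule arg_cong[of _ _ ennreal]) (simp add: a_def e'_def b_def)
  also have "\<dots> = ennreal (exp L) * ennreal d + ennreal tail + ennreal (enn2real \<eta>) + ennreal s + ennreal trunc + ennreal \<epsilon>"
    using d0 tail(1) trunc(1) \<epsilon> \<alpha> by (simp add: ennreal_plus ennreal_mult' s_def mult.commute)
  \<comment> \<open>For negative \<open>M\<close> the real square root is negative, so
    \<open>ennreal\<close> clips the right-hand side to 0, in accordance with
    \<open>max 0 M\<close>.\<close>
  also have "ennreal trunc = ennreal (sqrt M * S powr (- (q - 2) / 2))"
  proof (cases "0 \<le> M")
    case False
    then have "sqrt M * S powr (- (q - 2) / 2) \<le> 0" by (intro mult_nonpos_nonneg) auto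
    then show ?thesis using False by (simp add: trunc_def ennreal_neg)
  qed (simp add: trunc_def)
  finally show "W2 (terminal_law v) m \<le> ennreal (exp L) * ennreal d + ennreal (D * R powr (- (p - 2) / 2)) + \<eta>
    + ennreal (sqrt (\<alpha> * real CARD('d))) + ennreal (sqrt M * S powr (- (q - 2) / 2)) + ennreal \<epsilon>"
    by (simp only: terminal_law_def tail_def s_def \<eta>[symmetric])
qed

theorem proposition5p4:
  fixes \<nu> p\<^sub>0 lam M :: real
    and K :: "('d::finite, 'w::finite) coeff set"
    and \<mu> :: "('d, 'w) coeff \<Rightarrow> (real^'d) measure"
    and M\<^sub>p\<^sub>0 :: real
    and chi :: "real \<Rightarrow> real^'d \<Rightarrow> real"
    and \<alpha> S p C\<^sub>\<alpha>\<^sub>S :: real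
  defines "A \<equiv> admissible \<nu> p\<^sub>0 lam M"
  assumes "\<nu> > 0" and "p\<^sub>0 > 2" and "lam > 0" and "M > 0"
    and "K \<subseteq> A" and "compactin coeff_topology K"
    and "\<And>a. a \<in> A \<Longrightarrow> stationary a (\<mu> a)"
    and "\<And>a. a \<in> A \<Longrightarrow> (\<integral>\<^sup>+x. ennreal (norm x powr p\<^sub>0) \<partial>\<mu> a) \<le> ennreal M\<^sub>p\<^sub>0"
    and "cutoff_family chi"
    and "0 < \<alpha>" and "\<alpha> < 1" and "S > 0" and "p > 2"
  shows "\<exists>C::real. \<forall>R>0. \<forall>N :: ('d, 'w) coeff \<Rightarrow> real^'d \<Rightarrow> real \<Rightarrow> real^'d.
    (\<forall>a\<in>K. continuous_on (UNIV \<times> {0..1}) (\<lambda>(x, t). N a x t)) \<longrightarrow>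
    (\<forall>a\<in>K. local_lipschitz {0..1} UNIV (\<lambda>t x. N a x t)) \<longrightarrow>
    (\<forall>a\<in>K. \<forall>x. \<forall>t\<in>{0..1}. norm (N a x t) \<le> C\<^sub>\<alpha>\<^sub>S * (1 + norm x)) \<longrightarrow>
    (let L = enn2real (lip_const A \<mu> chi \<alpha> S R);
         \<delta> = field_error K \<mu> chi \<alpha> S R N
     in \<delta> < ennreal (R * exp (- L)) \<longrightarrow>
        (SUP a\<in>K. W2 (terminal_law (N a)) (\<mu> a)) \<le>
          ennreal (exp L) * \<delta>
          + ennreal (C * R powr (- (p - 2) / 2))
          + eps_trun A \<mu> chi \<alpha> S R
          + ennreal (sqrt (\<alpha> * real CARD('d)))
          + ennreal (sqrt M\<^sub>p\<^sub>0 * S powr (- (p\<^sub>0 - 2) / 2)))"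
proof -
  \<comment> \<open>One growth constant for both the learned and the truncated field, chosen before
    \<open>R\<close> and \<open>N\<close>.\<close>
  define C where "C = max (max 0 C\<^sub>\<alpha>\<^sub>S) (growth_const \<alpha> S TYPE('d))"
  define I where "I = (\<integral>\<^sup>+x. ennreal ((1 + norm x) powr p) \<partial>(gauss 1 :: (real^'d) measure))"
  have I: "I = ennreal (enn2real I)"
    unfolding I_def using gauss_powr_moment_finite[of 1 p, where 'd = 'd] \<open>p > 2\<close> by (simp add: less_top)
  \<comment> \<open>The square root of the tail coefficient in
    \<open>terminal_map_difference\<close>, integrated over the starting points.\<close>
  define D where "D = sqrt (4 * ((1 + C) * exp C) powr p * enn2real I)"
  have D: "ennreal (4 * ((1 + C) * exp C) powr p) * I \<le> ennreal (D\<^sup>2)" "0 \<le> D"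
    by (subst I) (simp_all add: D_def ennreal_mult'[symmetric])
  have m: "prob_space (\<mu> a) \<and> sets (\<mu> a) = sets borel" if "a \<in> A" for a
    using assms(8)[OF that] by (simp add: stationary_def)
  show ?thesis
  proof (intro exI[of _ D] allI impI)
    fix R :: real and N :: "('d, 'w) coeff \<Rightarrow> real^'d \<Rightarrow> real \<Rightarrow> real^'d"
    assume R: "0 < R"
      and cont: "\<forall>a\<in>K. continuous_on (UNIV \<times> {0..1}) (\<lambda>(x, t). N a x t)"
      and ll: "\<forall>a\<in>K. local_lipschitz {0..1} UNIV (\<lambda>t x. N a x t)"
      and gr: "\<forall>a\<in>K. \<forall>x. \<forall>t\<in>{0..1}. norm (N a x t) \<le> C\<^sub>\<alpha>\<^sub>S * (1 + norm x)"
    define L where "L = enn2real (lip_const A \<mu> chi \<alpha> S R)"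
    define \<delta> where "\<delta> = field_error K \<mu> chi \<alpha> S R N"
    have fin: "lip_const A \<mu> chi \<alpha> S R < \<infinity>"
      by (rule lip_const_finite) (use assms R m in auto)
    have "W2 (terminal_law (N a)) (\<mu> a) \<le> ennreal (exp L) * \<delta>
          + ennreal (D * R powr (- (p - 2) / 2)) + eps_trun A \<mu> chi \<alpha> S R
          + ennreal (sqrt (\<alpha> * real CARD('d))) + ennreal (sqrt M\<^sub>p\<^sub>0 * S powr (- (p\<^sub>0 - 2) / 2))"
      if \<delta>: "\<delta> < ennreal (R * exp (- L))" and aK: "a \<in> K" for a
    proof -
      define d where "d = enn2real \<delta>"
      have "\<delta> < top" using \<delta> ennreal_less_top by (rule less_trans)
      then have \<delta>d: "\<delta> = ennreal d" by (simp add: d_def)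
      have d0: "0 \<le> d" by (simp add: d_def)
      have "ennreal d < ennreal (R * exp (- L))" using \<delta> unfolding \<delta>d .
      then have "d < R * exp (- L)" using d0 by (simp add: ennreal_less_iff)
      \<comment> \<open>The smallness of the field error enters here, as the condition that the
        Gronwall deviation does not exceed \<open>R\<close>.\<close>
      then have e: "d * exp L \<le> R" by (simp add: exp_minus field_simps)
      have aA: "a \<in> A" using aK \<open>K \<subseteq> A\<close> by blast
      have "growth_field C (N a)"
      proof (rule growth_fieldI_local_lipschitz)
        fix x t assume t: "t \<in> {0..1::real}"
        have "norm (N a x t) \<le> C\<^sub>\<alpha>\<^sub>S * (1 + norm x)" using gr aK t by blast
        also have "\<dots> \<le> C * (1 + norm x)" by (intro mult_right_mono) (auto simp: C_def)
        finally show "norm (N a x t) \<le> C * (1 + norm x)" .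
      qed (use cont ll aK in \<open>auto simp: C_def\<close>)
      moreover have "norm (N a x t - cut_velocity chi \<alpha> S R (\<mu> a) x t) \<le> d"
        if "norm x \<le> 2 * R" "t \<in> {0..1}" for x t
      proof -
        have "ennreal (norm (N a x t - cut_velocity chi \<alpha> S R (\<mu> a) x t)) \<le> \<delta>"
          unfolding \<delta>_def field_error_def using aK that
          by (intro SUP_upper2[of a] SUP_upper2[of "(x, t)"]) auto
        then show ?thesis using d0 unfolding \<delta>d by (simp add: ennreal_le_iff)
      qed
      moreover have "W2 (rho_measure \<alpha> S (\<mu> a) 1) (terminal_law (cut_velocity chi \<alpha> S R (\<mu> a))) \<le> eps_trun A \<mu> chi \<alpha> S R"
        unfolding eps_trun_def using aA by (rule SUP_upper)
      ultimately show ?thesis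
        unfolding \<delta>d
        by (intro terminal_law_W2_le[where C = C])
          (use assms R m[OF aA] aA e D lip_const_lipschitz[OF fin aA] in \<open>auto simp: C_def L_def I_def\<close>)
    qed
    then show "let L = enn2real (lip_const A \<mu> chi \<alpha> S R); \<delta> = field_error K \<mu> chi \<alpha> S R N
     in \<delta> < ennreal (R * exp (- L)) \<longrightarrow>
        (SUP a\<in>K. W2 (terminal_law (N a)) (\<mu> a)) \<le>
          ennreal (exp L) * \<delta>
          + ennreal (D * R powr (- (p - 2) / 2))
          + eps_trun A \<mu> chi \<alpha> S R
          + ennreal (sqrt (\<alpha> * real CARD('d)))
          + ennreal (sqrt M\<^sub>p\<^sub>0 * S powr (- (p\<^sub>0 - 2) / 2))"
      unfolding Let_def L_def[symmetric] \<delta>_def[symmetric] by (intro impI SUP_least)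
  qed
qed

end
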